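(* Let $d$ be prime, $n\ge1$, $G$ positive and invertible over $\mathbb Z_d$, and $\sigma$ a pure $n$-qudit state. Then the channel $\mathcal E_\sigma(\rho)=\rho\boxtimes\sigma$ has Holevo capacity $\chi_H(\mathcal E_\sigma)=n\log d$ (the maximal possible value) if and only if $\sigma$ is a stabilizer state.
   Context: Fix a prime $d$; $\chi(k)=e^{2\pi ik/d}$, $X|k\rangle=|k+1\rangle$, $Z|k\rangle=\chi(k)|k\rangle$ on $\mathbb C^d$; Weyl operators $w(p,q)=\chi(-2^{-1}pq)Z^pX^q$ (odd $d$), $w(p,q)=i^{-pq}Z^pX^q$ ($d=2$), $w(\vec p,\vec q)=\bigotimes_kw(p_k,q_k)$. A pure stabilizer state is a common eigenvector of an abelian group of $d^n$ Weyl operators (up to phases). $G=\begin{pmatrix}g_{00}&g_{01}\\ g_{10}&g_{11}\end{pmatrix}$ over $\mathbb Z_d$, $\det G\not\equiv0$, $N=(\det G)^{-1}$; positive means all entries nonzero mod $d$. Key unitary $U|\vec i\rangle|\vec j\rangle=|Ng_{11}\vec i-Ng_{10}\vec j\rangle|-Ng_{01}\vec i+Ng_{00}\vec j\rangle$; $\rho\boxtimes\sigma=\mathrm{Tr}_B[U(\rho\otimes\sigma)U^\dagger]$. Holevo capacity: $\chi_H(\mathcal E)=\max_{\{p_i,\rho_i\}}\big[H(\sum_ip_i\mathcal E(\rho_i))-\sum_ip_iH(\mathcal E(\rho_i))\big]$, $H$ von Neumann entropy. *)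

theory Defs
  imports "Jordan_Normal_Form.Char_Poly" "HOL-Number_Theory.Cong"
begin

definition adj :: "complex mat \<Rightarrow> complex mat" where
  "adj A = mat (dim_col A) (dim_row A) (\<lambda>(i,j). cnj (A $$ (j,i)))"

definition density_op :: "nat \<Rightarrow> complex mat \<Rightarrow> bool" where
  "density_op D A \<longleftrightarrow> A \<in> carrier_mat D D \<and> adj A = A \<and>
     (\<forall>v \<in> carrier_vec D. 0 \<le> Re (conjugate v \<bullet> (A *\<^sub>v v))) \<and> (\<Sum>i<D. A $$ (i,i)) = 1"

text \<open>Von Neumann entropy (natural logarithm): H(A) = - sum of lambda ln lambda over the
  eigenvalues of A counted with algebraic multiplicity (roots of the characteristic
  polynomial); note that ln 0 = 0 in Isabelle, giving the convention 0 ln 0 = 0.\<close>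
definition vn_entropy :: "complex mat \<Rightarrow> real" where
  "vn_entropy A = - (\<Sum>x \<in> {x. poly (char_poly A) x = 0}.
       real (order x (char_poly A)) * (Re x * ln (Re x)))"

definition holevo_capacity :: "nat \<Rightarrow> (complex mat \<Rightarrow> complex mat) \<Rightarrow> real" where
  "holevo_capacity D E = Sup {vn_entropy
        (let M = (\<lambda>i. E (\<rho> i)) in
          mat (dim_row (M 0)) (dim_col (M 0)) (\<lambda>(r,c). \<Sum>i<m. complex_of_real (p i) * M i $$ (r,c)))
        - (\<Sum>i<m. p i * vn_entropy (E (\<rho> i))) | m p \<rho>.
        0 < (m::nat) \<and> (\<forall>i<m. 0 \<le> p i \<and> density_op D (\<rho> i)) \<and> (\<Sum>i<m. p i) = 1}"

text \<open>Tensor product of a matrix on C^D with a matrix on C^D (basis |a>|b> has index a*D+b),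
  and the partial trace over the second factor.\<close>
definition tensor :: "nat \<Rightarrow> complex mat \<Rightarrow> complex mat \<Rightarrow> complex mat" where
  "tensor D A B = mat (D*D) (D*D) (\<lambda>(r,c). A $$ (r div D, c div D) * B $$ (r mod D, c mod D))"

definition ptrace2 :: "nat \<Rightarrow> complex mat \<Rightarrow> complex mat" where
  "ptrace2 D M = mat D D (\<lambda>(a,a'). \<Sum>b<D. M $$ (a*D+b, a'*D+b))"

definition outer :: "complex vec \<Rightarrow> complex mat" where
  "outer \<psi> = mat (dim_vec \<psi>) (dim_vec \<psi>) (\<lambda>(i,j). \<psi> $ i * cnj (\<psi> $ j))"

text \<open>Computational basis of (C^d)^{\<otimes> n}: index i < d^n, the k-th qudit (k < n) is the
  k-th base-d digit. Elements of Z_d^n are encoded the same way.\<close>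
definition digit :: "nat \<Rightarrow> nat \<Rightarrow> nat \<Rightarrow> nat" where
  "digit d k i = (i div d ^ k) mod d"

definition enc :: "nat \<Rightarrow> nat \<Rightarrow> (nat \<Rightarrow> int) \<Rightarrow> nat" where
  "enc d n f = (\<Sum>k<n. nat (f k mod int d) * d ^ k)"

definition inv_mod :: "nat \<Rightarrow> int \<Rightarrow> int" where
  "inv_mod d a = (SOME N. 0 \<le> N \<and> N < int d \<and> [N * a = 1] (mod int d))"

definition key_perm :: "nat \<Rightarrow> nat \<Rightarrow> int \<Rightarrow> int \<Rightarrow> int \<Rightarrow> int \<Rightarrow> nat \<Rightarrow> nat" where
  "key_perm d n g00 g01 g10 g11 x =
     (let D = d ^ n; i = x div D; j = x mod D; N = inv_mod d (g00 * g11 - g01 * g10) in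
      enc d n (\<lambda>k. N * g11 * int (digit d k i) - N * g10 * int (digit d k j)) * D
      + enc d n (\<lambda>k. - N * g01 * int (digit d k i) + N * g00 * int (digit d k j)))"

definition key_unitary :: "nat \<Rightarrow> nat \<Rightarrow> int \<Rightarrow> int \<Rightarrow> int \<Rightarrow> int \<Rightarrow> complex mat" where
  "key_unitary d n g00 g01 g10 g11 =
     mat (d^n * d^n) (d^n * d^n) (\<lambda>(r,c). if r = key_perm d n g00 g01 g10 g11 c then 1 else 0)"

definition boxtimes :: "nat \<Rightarrow> nat \<Rightarrow> int \<Rightarrow> int \<Rightarrow> int \<Rightarrow> int \<Rightarrow> complex mat \<Rightarrow> complex mat \<Rightarrow> complex mat" where
  "boxtimes d n g00 g01 g10 g11 \<rho> \<sigma> =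
     (let U = key_unitary d n g00 g01 g10 g11 in
      ptrace2 (d ^ n) (U * tensor (d ^ n) \<rho> \<sigma> * adj U))"

text \<open>Single-qudit Weyl operators w(p,q), p q in {0..<d}:
  chi(k) = exp(2 pi i k / d), Z^p X^q |k> = chi(p(k+q)) |k+q>;
  w(p,q) = chi(-2^{-1} p q) Z^p X^q for odd d (2^{-1} = (d+1)/2 mod d),
  w(p,q) = i^{-pq} Z^p X^q for d = 2.\<close>
definition chi :: "nat \<Rightarrow> int \<Rightarrow> complex" where
  "chi d k = cis (2 * pi * of_int k / of_nat d)"

definition weyl_phase :: "nat \<Rightarrow> nat \<Rightarrow> nat \<Rightarrow> complex" where
  "weyl_phase d p q = (if d = 2 then \<i> powi (- int (p * q))
                        else chi d (- int ((d + 1) div 2) * int p * int q))"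

definition weyl1 :: "nat \<Rightarrow> nat \<Rightarrow> nat \<Rightarrow> complex mat" where
  "weyl1 d p q = mat d d (\<lambda>(r,c).
      if r = (c + q) mod d then weyl_phase d p q * chi d (int p * int r) else 0)"

text \<open>n-qudit Weyl operator w(p,q) = tensor product over qudits k < n of w(p_k,q_k);
  p, q < d^n encode vectors in Z_d^n.\<close>
definition weyl :: "nat \<Rightarrow> nat \<Rightarrow> nat \<Rightarrow> nat \<Rightarrow> complex mat" where
  "weyl d n p q = mat (d^n) (d^n) (\<lambda>(r,c).
      \<Prod>k<n. weyl1 d (digit d k p) (digit d k q) $$ (digit d k r, digit d k c))"

definition vadd :: "nat \<Rightarrow> nat \<Rightarrow> nat \<Rightarrow> nat \<Rightarrow> nat" where
  "vadd d n a b = enc d n (\<lambda>k. int (digit d k a) + int (digit d k b))"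

text \<open>A pure stabilizer state: a common eigenvector of an abelian group of d^n Weyl
  operators (up to phases), i.e. of all w(p,q) with (p,q) ranging over a set S of
  d^n labels that is closed under addition in Z_d^{2n}, contains 0, and whose Weyl
  operators pairwise commute.\<close>
definition stabilizer_state :: "nat \<Rightarrow> nat \<Rightarrow> complex vec \<Rightarrow> bool" where
  "stabilizer_state d n \<psi> \<longleftrightarrow> \<psi> \<in> carrier_vec (d^n) \<and> \<psi> \<noteq> 0\<^sub>v (d^n) \<and>
     (\<exists>S. S \<subseteq> {0..<d^n} \<times> {0..<d^n} \<and> card S = d ^ n \<and> (0,0) \<in> S \<and>
        (\<forall>(p,q)\<in>S. \<forall>(p',q')\<in>S. (vadd d n p p', vadd d n q q') \<in> S \<and>
             weyl d n p q * weyl d n p' q' = weyl d n p' q' * weyl d n p q) \<and>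
        (\<forall>(p,q)\<in>S. \<exists>c. weyl d n p q *\<^sub>v \<psi> = c \<cdot>\<^sub>v \<psi>))"

end

(* Let D = d^n and let Xi_A (p,q) = tr (w(p,q) A) be the characteristic function of A. By Parseval,
   sum |Xi_A|^2 = D tr A^2 for Hermitian A, and |Xi| is multiplicative under the convolution:
     |Xi_(rho [x] sigma) (p,q)| = |Xi_rho (N g11 p, g00 q)| |Xi_sigma (-N g10 p, g01 q)|,
   with all four coefficients invertible mod d.

   If the capacity is n log d, some inputs have outputs of entropy, hence of impurity
   1 - tr (E rho)^2 <= H (E rho), arbitrarily close to 0. Writing r = |Xi_rho|^2 and s = |Xi_sigma|^2,
   the bound s (1 - s) <= r (1 - s) + s (1 - r) then forces s to take only the values 0 and 1.
   The D labels with s = 1 are those whose Weyl operators have sigma as an eigenvector, and they form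
   the stabilizer group.

   Conversely, rescaling the labels of the stabilizer group of sigma preserves commutation, so the
   rescaled operators have a common eigenvector phi. All Weyl translates of phi have pure outputs,
   and their uniform mixture has the maximally mixed output. *)


theory Submission
  imports Defs "Jordan_Normal_Form.Schur_Decomposition"
begin

section \<open>Matrices\<close>

lemma mult_mat_entry:
  assumes "A \<in> carrier_mat l m" "B \<in> carrier_mat m k" "i < l" "j < k"
  shows "(A * B) $$ (i,j) = (\<Sum>t<m. A $$ (i,t) * B $$ (t,j))"
  using assms by (auto simp: scalar_prod_def atLeast0LessThan intro!: sum.cong)

lemma mult_mat_vec_entry:
  assumes "A \<in> carrier_mat l m" "v \<in> carrier_vec m" "i < l"
  shows "(A *\<^sub>v v) $ i = (\<Sum>j<m. A $$ (i,j) * v $ j)"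
  using assms by (auto simp: scalar_prod_def atLeast0LessThan intro!: sum.cong)

lemma smult_mat_mult_vec:
  "v \<in> carrier_vec (dim_col A) \<Longrightarrow> (c \<cdot>\<^sub>m A) *\<^sub>v v = c \<cdot>\<^sub>v (A *\<^sub>v v)"
  by (rule eq_vecI) (auto simp: smult_scalar_prod_distrib[of _ "dim_col A"])

lemma nonzero_vec_has_nonzero_entry:
  assumes "v \<in> carrier_vec m" "v \<noteq> 0\<^sub>v m"
  obtains i where "i < m" "v $ i \<noteq> 0"
  using assms by (metis carrier_vecD eq_vecI index_zero_vec)

lemma permutation_conjugate_entry:
  assumes M: "M \<in> carrier_mat m m" and w: "\<And>r. r < m \<Longrightarrow> w r < m" and xy: "x < m" "y < m"
    and U: "U \<in> carrier_mat m m"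
      "\<And>r c. r < m \<Longrightarrow> c < m \<Longrightarrow> U $$ (r,c) = (if c = w r then 1 else 0)"
  shows "(U * M * adj U) $$ (x,y) = M $$ (w x, w y)"
proof -
  have adj: "adj U \<in> carrier_mat m m" using U(1) by (simp add: adj_def)
  have UM: "(U * M) $$ (x,t) = M $$ (w x, t)" if "t < m" for t
  proof -
    have "(U * M) $$ (x,t) = (\<Sum>s<m. if s = w x then M $$ (w x, t) else 0)"
      unfolding mult_mat_entry[OF U(1) M xy(1) that] using xy by (intro sum.cong) (auto simp: U(2))
    then show ?thesis using w xy by simp
  qed
  have "(U * M * adj U) $$ (x,y) = (\<Sum>t<m. (U * M) $$ (x,t) * adj U $$ (t,y))"
    by (rule mult_mat_entry[OF mult_carrier_mat[OF U(1) M] adj xy])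
  also have "\<dots> = (\<Sum>t<m. if t = w y then M $$ (w x, w y) else 0)"
    using xy U by (intro sum.cong) (auto simp: UM adj_def)
  finally show ?thesis using w xy by simp
qed

definition trace :: "'a :: comm_monoid_add mat \<Rightarrow> 'a" where
  "trace A = (\<Sum>i<dim_row A. A $$ (i,i))"

lemma trace_mult_commute:
  fixes A :: "'a :: comm_ring_1 mat"
  assumes A: "A \<in> carrier_mat m k" and B: "B \<in> carrier_mat k m"
  shows "trace (A * B) = trace (B * A)"
proof -
  have "trace (A * B) = (\<Sum>i<m. \<Sum>t<k. A $$ (i,t) * B $$ (t,i))"
    unfolding trace_def using A by (auto simp: mult_mat_entry[OF A B] simp del: index_mult_mat(1))
  also have "\<dots> = (\<Sum>t<k. \<Sum>i<m. B $$ (t,i) * A $$ (i,t))"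
    by (subst sum.swap) (simp add: mult.commute)
  also have "\<dots> = trace (B * A)"
    unfolding trace_def using B by (auto simp: mult_mat_entry[OF B A] simp del: index_mult_mat(1))
  finally show ?thesis .
qed

lemma trace_similar_mat:
  fixes A :: "'a :: comm_ring_1 mat"
  assumes A: "A \<in> carrier_mat m m" and "similar_mat A B"
  shows "trace A = trace B"
proof -
  obtain P Q where "similar_mat_wit A B P Q" using assms by (auto simp: similar_mat_def)
  note sim = similar_mat_witD2[OF A this]
  have "trace A = trace (Q * (P * B))"
    unfolding sim(3) using sim(5-7) by (intro trace_mult_commute[of _ m m]) auto
  also have "Q * (P * B) = B"
    using sim(2,5-7) by (simp flip: assoc_mult_mat[of Q m m P m B m])
  finally show ?thesis .
qed

lemma upper_triangular_mult_diag:
  assumes A: "A \<in> carrier_mat m m" "upper_triangular A"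
    and B: "B \<in> carrier_mat m m" "upper_triangular B" and i: "i < m"
  shows "(A * B) $$ (i,i) = A $$ (i,i) * B $$ (i,i)"
proof -
  have "A $$ (i,t) * B $$ (t,i) = 0" if "t < m" "t \<noteq> i" for t
    using that i A B upper_triangularD[of A t i] upper_triangularD[of B i t]
    by (cases t i rule: linorder_cases) auto
  then have "(A * B) $$ (i,i) = (\<Sum>t<m. if t = i then A $$ (i,i) * B $$ (i,i) else 0)"
    unfolding mult_mat_entry[OF A(1) B(1) i i] by (intro sum.cong) auto
  then show ?thesis using i by simp
qed

lemma trace_char_poly_roots:
  fixes A :: "'a :: conjugatable_ordered_field mat"
  assumes A: "A \<in> carrier_mat m m" and as: "char_poly A = (\<Prod>a\<leftarrow>as. [:- a, 1:])"
  shows "trace A = sum_list as" "trace (A * A) = (\<Sum>a\<leftarrow>as. a\<^sup>2)"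
proof -
  obtain B P Q where "schur_decomposition A as = (B,P,Q)"
    by (cases "schur_decomposition A as") auto
  with schur_decomposition[OF A as] have sim: "similar_mat_wit A B P Q"
    and ut: "upper_triangular B" and diag: "diag_mat B = as"
    by auto
  note B = similar_mat_witD2(5)[OF A sim]
  have sum_diag: "(\<Sum>a\<leftarrow>as. f a) = (\<Sum>i<m. f (B $$ (i,i)))" for f :: "'a \<Rightarrow> 'a"
    unfolding diag[symmetric] diag_mat_def using B
    by (simp add: interv_sum_list_conv_sum_set_nat atLeast0LessThan o_def)
  have "similar_mat A B" using sim by (auto simp: similar_mat_def)
  then have "trace A = trace B" by (rule trace_similar_mat[OF A])
  then show "trace A = sum_list as" using B sum_diag[of "\<lambda>a. a"] by (simp add: trace_def)
  have "A ^\<^sub>m 2 = A * A" "B ^\<^sub>m 2 = B * B" using A B by (auto simp: numeral_2_eq_2)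
  then have "similar_mat (A * A) (B * B)"
    using similar_mat_wit_pow[OF sim, of 2] by (auto simp: similar_mat_def)
  then have "trace (A * A) = trace (B * B)" by (rule trace_similar_mat[OF mult_carrier_mat[OF A A]])
  also have "\<dots> = (\<Sum>i<m. (B $$ (i,i))\<^sup>2)"
    unfolding trace_def using B upper_triangular_mult_diag[OF B ut B ut]
    by (auto simp: power2_eq_square simp del: index_mult_mat(1) intro!: sum.cong)
  finally show "trace (A * A) = (\<Sum>a\<leftarrow>as. a\<^sup>2)" by (simp add: sum_diag)
qed

lemma order_prod_list_linear:
  "Polynomial.order x (\<Prod>a\<leftarrow>as. [:- a, 1:]) = count_list as (x :: 'a :: field)"
proof -
  have "(\<Sum>a\<leftarrow>as. Polynomial.order x [:- a, 1:]) = count_list as x"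
    by (induction as) (auto simp: order_linear')
  moreover have "Polynomial.order x (\<Prod>a\<leftarrow>as. [:- a, 1:]) = (\<Sum>a\<leftarrow>as. Polynomial.order x [:- a, 1:])"
    by (subst order_prod_list) (auto simp: o_def)
  ultimately show ?thesis by simp
qed

lemma sum_count_list_mult:
  fixes g :: "'a \<Rightarrow> 'b :: semiring_1"
  assumes "finite X" "set xs \<subseteq> X"
  shows "(\<Sum>x\<in>X. of_nat (count_list xs x) * g x) = (\<Sum>x\<leftarrow>xs. g x)"
  using assms(2)
proof (induction xs)
  case (Cons a xs)
  have "(\<Sum>x\<in>X. of_nat (count_list (a # xs) x) * g x)
      = (\<Sum>x\<in>X. (if x = a then g a else 0) + of_nat (count_list xs x) * g x)"
    by (intro sum.cong) (auto simp: algebra_simps)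
  then show ?case using Cons assms(1) by (simp add: sum.distrib)
qed simp

section \<open>Von Neumann entropy\<close>

definition prob_list :: "real list \<Rightarrow> bool" where
  "prob_list ps \<longleftrightarrow> (\<forall>p\<in>set ps. 0 \<le> p) \<and> sum_list ps = 1"

definition shannon_entropy :: "real list \<Rightarrow> real" where
  "shannon_entropy ps = - (\<Sum>p\<leftarrow>ps. p * ln p)"

lemma prob_list_square_le:
  assumes "prob_list ps" "p \<in> set ps"
  shows "p\<^sup>2 \<le> p"
proof -
  have "p \<le> 1" using assms member_le_sum_list[of p ps] by (auto simp: prob_list_def)
  then show ?thesis using assms by (auto simp: prob_list_def power2_eq_square mult_left_le)
qed

lemma sum_squares_prob_list_le_1:
  assumes "prob_list ps"
  shows "(\<Sum>p\<leftarrow>ps. p\<^sup>2) \<le> 1"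
proof -
  have "(\<Sum>p\<leftarrow>ps. p\<^sup>2) \<le> (\<Sum>p\<leftarrow>ps. p)" by (intro sum_list_mono prob_list_square_le[OF assms])
  then show ?thesis using assms by (simp add: prob_list_def)
qed

lemma shannon_entropy_ge_1_minus_sum_squares:
  assumes "prob_list ps"
  shows "1 - (\<Sum>p\<leftarrow>ps. p\<^sup>2) \<le> shannon_entropy ps"
proof -
  have "p * ln p \<le> p\<^sup>2 - p" if "p \<in> set ps" for p
  proof (cases "p = 0")
    case False
    then have "p * ln p \<le> p * (p - 1)"
      using that assms by (intro mult_left_mono ln_le_minus_one) (auto simp: prob_list_def less_le)
    then show ?thesis by (simp add: power2_eq_square algebra_simps)
  qed simp
  then have "(\<Sum>p\<leftarrow>ps. p * ln p) \<le> (\<Sum>p\<leftarrow>ps. p\<^sup>2 - p)" by (rule sum_list_mono)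
  then show ?thesis using assms by (simp add: shannon_entropy_def prob_list_def sum_list_subtractf)
qed

lemma shannon_entropy_eq_0:
  assumes ps: "prob_list ps" and sq: "(\<Sum>p\<leftarrow>ps. p\<^sup>2) = 1"
  shows "shannon_entropy ps = 0"
proof -
  have "(\<Sum>p\<leftarrow>ps. p - p\<^sup>2) = 0" using ps sq by (simp add: prob_list_def sum_list_subtractf)
  moreover have "0 \<le> x" if "x \<in> set (map (\<lambda>p. p - p\<^sup>2) ps)" for x
    using that prob_list_square_le[OF ps] by auto
  ultimately have "\<forall>x \<in> set (map (\<lambda>p. p - p\<^sup>2) ps). x = 0"
    using sum_list_nonneg_eq_0_iff by blast
  then have "(\<Sum>p\<leftarrow>ps. p * ln p) = (\<Sum>p\<leftarrow>ps. 0)"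
    by (intro arg_cong[where f = sum_list] map_cong) (auto simp: power2_eq_square)
  then show ?thesis unfolding shannon_entropy_def by simp
qed

lemma shannon_entropy_le_ln_length:
  assumes "prob_list ps"
  shows "shannon_entropy ps \<le> ln (real (length ps))"
proof -
  define m where "m = real (length ps)"
  have m: "m > 0" using assms by (cases ps) (auto simp: m_def prob_list_def)
  have "- (p * ln p) \<le> 1 / m - p + p * ln m" if "p \<in> set ps" for p
  proof (cases "p = 0")
    case False
    then have pos: "p > 0" using that assms by (auto simp: prob_list_def less_le)
    then have "p * ln (1 / (p * m)) \<le> p * (1 / (p * m) - 1)"
      using m by (intro mult_left_mono ln_le_minus_one) auto
    also have "\<dots> = 1 / m - p" using pos by (simp add: field_simps)
    also have "ln (1 / (p * m)) = - ln p - ln m" using pos m by (simp add: ln_div ln_mult)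
    finally show ?thesis by (simp add: algebra_simps)
  qed (use m in simp)
  then have "(\<Sum>p\<leftarrow>ps. - (p * ln p)) \<le> (\<Sum>p\<leftarrow>ps. 1 / m - p + p * ln m)"
    by (rule sum_list_mono)
  also have "\<dots> = real (length ps) * (1 / m) - sum_list ps + sum_list ps * ln m"
    by (induction ps) (auto simp: algebra_simps add_divide_distrib)
  also have "\<dots> = ln m" using assms m by (simp add: prob_list_def m_def)
  finally show ?thesis by (simp add: shannon_entropy_def uminus_sum_list_map o_def flip: m_def)
qed

lemma vn_entropy_char_poly_roots:
  assumes "char_poly A = (\<Prod>a\<leftarrow>as. [:- a, 1:])"
  shows "vn_entropy A = shannon_entropy (map Re as)"
proof -
  have "{x. poly (char_poly A) x = 0} = set as"
    unfolding assms by (induction as) auto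
  then show ?thesis
    unfolding vn_entropy_def shannon_entropy_def
    by (simp add: assms order_prod_list_linear sum_count_list_mult o_def)
qed

section \<open>Common eigenvectors of commuting matrices\<close>

definition mat_poly_vec :: "'a :: field mat \<Rightarrow> 'a poly \<Rightarrow> 'a vec \<Rightarrow> 'a vec" where
  "mat_poly_vec A p v = fold_coeffs (\<lambda>a w. a \<cdot>\<^sub>v v + A *\<^sub>v w) p (0\<^sub>v (dim_row A))"

context
  fixes A :: "'a :: field mat" and v :: "'a vec" and m :: nat
  assumes A: "A \<in> carrier_mat m m" and v: "v \<in> carrier_vec m"
begin

lemma mat_poly_vec_0: "mat_poly_vec A 0 v = 0\<^sub>v m"
  using A by (simp add: mat_poly_vec_def)

lemma mat_poly_vec_pCons: "mat_poly_vec A (pCons a p) v = a \<cdot>\<^sub>v v + A *\<^sub>v mat_poly_vec A p v"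
proof -
  have "0 \<cdot>\<^sub>v v + A *\<^sub>v 0\<^sub>v m = 0\<^sub>v m" using A v by (auto intro!: eq_vecI)
  then show ?thesis
    using A by (cases "a = 0 \<and> p = 0") (auto simp: mat_poly_vec_def)
qed

lemma mat_poly_vec_carrier: "mat_poly_vec A p v \<in> carrier_vec m"
  using A v by (induction p) (auto simp: mat_poly_vec_0 mat_poly_vec_pCons)

lemma mat_poly_vec_smult: "mat_poly_vec A (Polynomial.smult c p) v = c \<cdot>\<^sub>v mat_poly_vec A p v"
proof (induction p)
  case 0
  show ?case by (auto simp: mat_poly_vec_0)
next
  case (pCons a p)
  have "A *\<^sub>v (c \<cdot>\<^sub>v mat_poly_vec A p v) = c \<cdot>\<^sub>v (A *\<^sub>v mat_poly_vec A p v)"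
    using A mat_poly_vec_carrier by (rule mult_mat_vec)
  then show ?case
    using A v mat_poly_vec_carrier[of p] pCons.IH
    by (simp add: mat_poly_vec_pCons smult_add_distrib_vec[of _ m] smult_smult_assoc)
qed

lemma mat_poly_vec_add: "mat_poly_vec A (p + q) v = mat_poly_vec A p v + mat_poly_vec A q v"
proof (induction p q rule: poly_induct2)
  case 0
  show ?case by (simp add: mat_poly_vec_0)
next
  case (pCons a p b q)
  have "A *\<^sub>v (mat_poly_vec A p v + mat_poly_vec A q v)
      = A *\<^sub>v mat_poly_vec A p v + A *\<^sub>v mat_poly_vec A q v"
    using A mat_poly_vec_carrier mat_poly_vec_carrier by (rule mult_add_distrib_mat_vec)
  then show ?case
    using A v mat_poly_vec_carrier[of p] mat_poly_vec_carrier[of q] pCons.IH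
    by (auto simp: mat_poly_vec_pCons algebra_simps intro!: eq_vecI)
qed

lemma mat_poly_vec_mult_linear:
  "mat_poly_vec A ([:- a, 1:] * q) v = A *\<^sub>v mat_poly_vec A q v - a \<cdot>\<^sub>v mat_poly_vec A q v"
proof -
  have "mat_poly_vec A ([:- a, 1:] * q) v
      = (- a) \<cdot>\<^sub>v mat_poly_vec A q v + mat_poly_vec A (pCons 0 q) v"
    by (simp flip: mat_poly_vec_add mat_poly_vec_smult)
  then show ?thesis
    using A v mat_poly_vec_carrier[of q] by (auto simp: mat_poly_vec_pCons intro!: eq_vecI)
qed

lemma mat_poly_vec_preserves_eigenvector:
  assumes B: "B \<in> carrier_mat m m" "A * B = B * A" and eig: "B *\<^sub>v v = c \<cdot>\<^sub>v v"
  shows "B *\<^sub>v mat_poly_vec A p v = c \<cdot>\<^sub>v mat_poly_vec A p v"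
proof (induction p)
  case 0
  show ?case using B by (auto simp: mat_poly_vec_0 intro!: eq_vecI)
next
  case (pCons a p)
  let ?w = "mat_poly_vec A p v"
  note w = mat_poly_vec_carrier[of p]
  have "B *\<^sub>v (a \<cdot>\<^sub>v v + A *\<^sub>v ?w) = B *\<^sub>v (a \<cdot>\<^sub>v v) + B *\<^sub>v (A *\<^sub>v ?w)"
    using A B v w by (intro mult_add_distrib_mat_vec) auto
  also have "B *\<^sub>v (A *\<^sub>v ?w) = A *\<^sub>v (B *\<^sub>v ?w)"
    using A B w by (metis assoc_mult_mat_vec)
  also have "A *\<^sub>v (B *\<^sub>v ?w) = c \<cdot>\<^sub>v (A *\<^sub>v ?w)"
    unfolding pCons.IH using A w by (rule mult_mat_vec)
  also have "B *\<^sub>v (a \<cdot>\<^sub>v v) = a \<cdot>\<^sub>v (c \<cdot>\<^sub>v v)"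
    unfolding eig[symmetric] using B(1) v by (rule mult_mat_vec)
  finally show ?case
    unfolding mat_poly_vec_pCons using A v w
    by (auto simp: algebra_simps simp del: index_mult_mat_vec intro!: eq_vecI)
qed

lemma mat_poly_vec_sum_smult_entry:
  assumes "i < m"
  shows "mat_poly_vec A (\<Sum>k\<in>K. Polynomial.smult (c k) (f k)) v $ i
    = (\<Sum>k\<in>K. c k * mat_poly_vec A (f k) v $ i)"
  using assms carrier_vecD[OF mat_poly_vec_carrier]
  by (induction K rule: infinite_finite_induct)
    (simp_all add: mat_poly_vec_0 mat_poly_vec_add mat_poly_vec_smult)

lemma mat_poly_vec_annihilator:
  obtains p where "p \<noteq> 0" "mat_poly_vec A p v = 0\<^sub>v m"
proof -
  \<comment> \<open>The columns of \<open>K\<close> are \<open>v, A v, \<dots>, A\<^sup>m v\<close>, padded with a zero row to make \<open>K\<close> square.\<close>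
  define K where
    "K = mat (Suc m) (Suc m) (\<lambda>(i,k). if i < m then mat_poly_vec A (monom 1 k) v $ i else 0)"
  have K: "K \<in> carrier_mat (Suc m) (Suc m)" by (simp add: K_def)
  have "K = mat\<^sub>r (Suc m) (Suc m) (\<lambda>i. if i = m then 0\<^sub>v (Suc m) else row K i)"
    by (rule eq_matI) (auto simp: K_def)
  then have "det K = 0" using det_row_0[of m "Suc m" "row K"] K by auto
  then obtain w where w: "w \<in> carrier_vec (Suc m)" "w \<noteq> 0\<^sub>v (Suc m)" "K *\<^sub>v w = 0\<^sub>v (Suc m)"
    using det_0_iff_vec_prod_zero_field[OF K] by blast
  define p where "p = (\<Sum>k<Suc m. Polynomial.smult (w $ k) (monom 1 k))"
  have coeff: "coeff p k = w $ k" if "k < Suc m" for k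
    using that unfolding p_def by (simp add: coeff_sum smult_monom del: sum.lessThan_Suc)
  obtain k where "k < Suc m" "w $ k \<noteq> 0" using nonzero_vec_has_nonzero_entry[OF w(1,2)] .
  then have "p \<noteq> 0" using coeff[of k] by auto
  moreover have "mat_poly_vec A p v = 0\<^sub>v m"
  proof (rule eq_vecI)
    fix i assume "i < dim_vec (0\<^sub>v m :: 'a vec)"
    then have i: "i < m" by simp
    have "mat_poly_vec A p v $ i = (K *\<^sub>v w) $ i"
      using i unfolding p_def mat_poly_vec_sum_smult_entry[OF i]
      by (subst mult_mat_vec_entry[OF K w(1)]) (auto simp: K_def intro!: sum.cong)
    then show "mat_poly_vec A p v $ i = 0\<^sub>v m $ i" using i w(3) by simp
  qed (use mat_poly_vec_carrier[of p] in simp)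
  ultimately show ?thesis by (rule that)
qed

end

text \<open>A root \<open>a\<close> of an annihilating polynomial \<open>p = (X - a) q\<close> of minimal degree turns \<open>q(A) v\<close> into an
  eigenvector.\<close>

lemma mat_poly_vec_eigenvector_exists:
  fixes A :: "'a :: alg_closed_field mat"
  assumes A: "A \<in> carrier_mat m m" and v: "v \<in> carrier_vec m" "v \<noteq> 0\<^sub>v m"
  obtains q a where "mat_poly_vec A q v \<noteq> 0\<^sub>v m"
    "A *\<^sub>v mat_poly_vec A q v = a \<cdot>\<^sub>v mat_poly_vec A q v"
proof -
  note poly_vec = mat_poly_vec_carrier[OF A v(1)]
  obtain p where p: "p \<noteq> 0" "mat_poly_vec A p v = 0\<^sub>v m"
    and least: "\<And>q. q \<noteq> 0 \<Longrightarrow> mat_poly_vec A q v = 0\<^sub>v m \<Longrightarrow> degree p \<le> degree q"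
    using mat_poly_vec_annihilator[OF A v(1)]
      ex_has_least_nat[of "\<lambda>p. p \<noteq> 0 \<and> mat_poly_vec A p v = 0\<^sub>v m" _ degree] by metis
  have "degree p \<noteq> 0"
  proof
    assume "degree p = 0"
    then obtain a where a: "p = [:a:]" by (rule degree_eq_zeroE)
    obtain i where i: "i < m" "v $ i \<noteq> 0" using nonzero_vec_has_nonzero_entry[OF v] .
    have "mat_poly_vec A p v $ i = a * v $ i"
      unfolding a using A v i by (simp add: mat_poly_vec_pCons[OF A v(1)] mat_poly_vec_0[OF A v(1)])
    then show False using i a p by simp
  qed
  then obtain a where "poly p a = 0" using alg_closed_imp_poly_has_root[of p] by auto
  then obtain q where q: "p = [:- a, 1:] * q" by (auto simp: poly_eq_0_iff_dvd elim: dvdE)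
  have "q \<noteq> 0" using q p(1) by auto
  then have "degree q < degree p" unfolding q by (subst degree_mult_eq) auto
  then have "mat_poly_vec A q v \<noteq> 0\<^sub>v m" using least[of q] \<open>q \<noteq> 0\<close> by auto
  moreover have "A *\<^sub>v mat_poly_vec A q v = a \<cdot>\<^sub>v mat_poly_vec A q v"
  proof -
    have "A *\<^sub>v mat_poly_vec A q v - a \<cdot>\<^sub>v mat_poly_vec A q v = 0\<^sub>v m"
      using p(2) unfolding q mat_poly_vec_mult_linear[OF A v(1)] .
    then have "(A *\<^sub>v mat_poly_vec A q v - a \<cdot>\<^sub>v mat_poly_vec A q v) $ i = 0" if "i < m" for i
      using that by simp
    then show ?thesis using A poly_vec[of q] by (auto intro!: eq_vecI)
  qed
  ultimately show ?thesis by (rule that)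
qed

theorem commuting_matrices_common_eigenvector:
  fixes F :: "'a :: alg_closed_field mat set"
  assumes "finite F" "m > 0"
    and "\<And>A. A \<in> F \<Longrightarrow> A \<in> carrier_mat m m"
    and "\<And>A B. A \<in> F \<Longrightarrow> B \<in> F \<Longrightarrow> A * B = B * A"
  obtains v where "v \<in> carrier_vec m" "v \<noteq> 0\<^sub>v m" "\<And>A. A \<in> F \<Longrightarrow> \<exists>c. A *\<^sub>v v = c \<cdot>\<^sub>v v"
proof -
  have "\<exists>v\<in>carrier_vec m. v \<noteq> 0\<^sub>v m \<and> (\<forall>A\<in>F. \<exists>c. A *\<^sub>v v = c \<cdot>\<^sub>v v)"
    using assms
  proof (induction F rule: finite_induct)
    case empty
    have "unit_vec m 0 \<noteq> 0\<^sub>v m" using \<open>m > 0\<close> by simp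
    then show ?case by (intro bexI[of _ "unit_vec m 0"]) auto
  next
    case (insert A F)
    obtain v where v: "v \<in> carrier_vec m" "v \<noteq> 0\<^sub>v m"
      and eig: "\<And>B. B \<in> F \<Longrightarrow> \<exists>c. B *\<^sub>v v = c \<cdot>\<^sub>v v"
      using insert by auto
    have A: "A \<in> carrier_mat m m" using insert.prems by simp
    obtain q a where q: "mat_poly_vec A q v \<noteq> 0\<^sub>v m"
      "A *\<^sub>v mat_poly_vec A q v = a \<cdot>\<^sub>v mat_poly_vec A q v"
      using mat_poly_vec_eigenvector_exists[OF A v] .
    have "\<exists>c. B *\<^sub>v mat_poly_vec A q v = c \<cdot>\<^sub>v mat_poly_vec A q v" if "B \<in> F" for B
      using mat_poly_vec_preserves_eigenvector[OF A v(1), of B] eig[OF that] insert.prems that by blast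
    then show ?case
      using q mat_poly_vec_carrier[OF A v(1)] by (intro bexI[of _ "mat_poly_vec A q v"]) auto
  qed
  then show ?thesis using that by blast
qed

section \<open>Density operators\<close>

lemma quadratic_form_eq_sum:
  assumes "A \<in> carrier_mat m m" "v \<in> carrier_vec m"
  shows "conjugate v \<bullet> (A *\<^sub>v v) = (\<Sum>i<m. \<Sum>j<m. cnj (v $ i) * A $$ (i,j) * v $ j)"
  using assms
  by (auto simp: scalar_prod_def atLeast0LessThan sum_distrib_left mult.assoc intro!: sum.cong)

lemma density_op_iff:
  "density_op m A \<longleftrightarrow> A \<in> carrier_mat m m \<and> trace A = 1 \<and>
     (\<forall>i<m. \<forall>j<m. cnj (A $$ (j,i)) = A $$ (i,j)) \<and>
     (\<forall>f. 0 \<le> Re (\<Sum>i<m. \<Sum>j<m. cnj (f i) * A $$ (i,j) * f j))"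
proof (cases "A \<in> carrier_mat m m")
  case A: True
  have adj: "adj A = A \<longleftrightarrow> (\<forall>i<m. \<forall>j<m. cnj (A $$ (j,i)) = A $$ (i,j))"
    using A by (auto simp: adj_def mat_eq_iff)
  have trace: "(\<Sum>i<m. A $$ (i,i)) = trace A" using A by (simp add: trace_def)
  have form: "(\<forall>v\<in>carrier_vec m. 0 \<le> Re (conjugate v \<bullet> (A *\<^sub>v v)))
    \<longleftrightarrow> (\<forall>f. 0 \<le> Re (\<Sum>i<m. \<Sum>j<m. cnj (f i) * A $$ (i,j) * f j))" (is "?vec \<longleftrightarrow> ?fun")
  proof (intro iffI allI ballI)
    fix f :: "nat \<Rightarrow> complex"
    assume ?vec
    moreover have f: "vec m f \<in> carrier_vec m" by simp
    ultimately have "0 \<le> Re (conjugate (vec m f) \<bullet> (A *\<^sub>v vec m f))" by blast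
    then show "0 \<le> Re (\<Sum>i<m. \<Sum>j<m. cnj (f i) * A $$ (i,j) * f j)"
      unfolding quadratic_form_eq_sum[OF A f] by simp
  next
    fix v :: "complex vec"
    assume ?fun "v \<in> carrier_vec m"
    then show "0 \<le> Re (conjugate v \<bullet> (A *\<^sub>v v))"
      by (simp only: quadratic_form_eq_sum[OF A])
  qed
  show ?thesis unfolding density_op_def adj trace form by (simp only: conj_ac)
qed (simp add: density_op_def)

lemma
  assumes "density_op m A"
  shows density_op_carrier: "A \<in> carrier_mat m m"
    and trace_density_op: "trace A = 1"
    and density_op_hermitian: "i < m \<Longrightarrow> j < m \<Longrightarrow> cnj (A $$ (j,i)) = A $$ (i,j)"
    and density_op_nonneg: "0 \<le> Re (\<Sum>i<m. \<Sum>j<m. cnj (f i) * A $$ (i,j) * f j)"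
  using assms unfolding density_op_iff by blast+

lemma density_op_pullback_nonneg:
  assumes A: "density_op m A" and K: "finite K" "h ` K \<subseteq> {..<m}"
  shows "0 \<le> Re (\<Sum>k\<in>K. \<Sum>l\<in>K. cnj (g k) * A $$ (h k, h l) * g l)"
proof -
  define f where "f i = (\<Sum>k\<in>K. if h k = i then g k else 0)" for i
  have collect: "(\<Sum>i<m. (\<Sum>k\<in>K. if h k = i then a k else 0) * b i) = (\<Sum>k\<in>K. a k * b (h k))"
    for a b :: "_ \<Rightarrow> complex"
  proof -
    have "(\<Sum>i<m. (\<Sum>k\<in>K. if h k = i then a k else 0) * b i)
        = (\<Sum>k\<in>K. \<Sum>i<m. if i = h k then a k * b i else 0)"
      unfolding sum_distrib_right by (subst sum.swap) (auto intro!: sum.cong)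
    also have "\<dots> = (\<Sum>k\<in>K. a k * b (h k))"
      using K by (intro sum.cong) (auto simp: image_subset_iff)
    finally show ?thesis .
  qed
  have cnj_f: "cnj (f i) = (\<Sum>k\<in>K. if h k = i then cnj (g k) else 0)" for i
    unfolding f_def cnj_sum if_distrib[of cnj] complex_cnj_zero ..
  have "(\<Sum>i<m. \<Sum>j<m. cnj (f i) * A $$ (i,j) * f j)
      = (\<Sum>i<m. (\<Sum>k\<in>K. if h k = i then cnj (g k) else 0) * (\<Sum>j<m. f j * A $$ (i,j)))"
    unfolding cnj_f[symmetric] by (simp add: sum_distrib_left mult_ac)
  also have "\<dots> = (\<Sum>k\<in>K. \<Sum>l\<in>K. cnj (g k) * A $$ (h k, h l) * g l)"
    unfolding collect unfolding f_def collect by (simp add: sum_distrib_left mult_ac)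
  finally show ?thesis using density_op_nonneg[OF A, of f] by simp
qed

lemma density_op_entry_le:
  assumes A: "density_op m A" and ij: "i < m" "j < m"
  shows "cmod (A $$ (i,j)) \<le> (Re (A $$ (i,i)) + Re (A $$ (j,j))) / 2"
proof -
  obtain u where u: "cmod u = 1" "u * A $$ (i,j) = - of_real (cmod (A $$ (i,j)))"
  proof (cases "A $$ (i,j) = 0")
    case False
    show ?thesis
      by (rule that[of "- of_real (cmod (A $$ (i,j))) / A $$ (i,j)"])
        (use False in \<open>simp_all add: norm_divide\<close>)
  qed (use that[of 1] in simp)
  define h g where "h b = (if b then j else i)" and "g b = (if b then u else 1)" for b
  have "0 \<le> Re (\<Sum>k\<in>UNIV. \<Sum>l\<in>UNIV. cnj (g k) * A $$ (h k, h l) * g l)"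
    using ij by (intro density_op_pullback_nonneg[OF A]) (auto simp: h_def)
  also have "(\<Sum>k\<in>UNIV. \<Sum>l\<in>UNIV. cnj (g k) * A $$ (h k, h l) * g l)
      = A $$ (i,i) + u * A $$ (i,j) + cnj (u * A $$ (i,j)) + (u * cnj u) * A $$ (j,j)"
    using density_op_hermitian[OF A ij(2,1)] by (simp add: UNIV_bool h_def g_def algebra_simps)
  also have "u * cnj u = 1" using u(1) by (simp add: complex_norm_square[symmetric])
  finally show ?thesis by (simp add: u(2))
qed

lemma density_op_eigenvalue:
  assumes A: "density_op m A" and "eigenvalue A x"
  shows "x = of_real (Re x)" "0 \<le> Re x"
proof -
  note carrier = density_op_carrier[OF A]
  obtain v where v: "v \<in> carrier_vec m" "v \<noteq> 0\<^sub>v m" "A *\<^sub>v v = x \<cdot>\<^sub>v v"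
    using assms(2) carrier by (auto simp: eigenvalue_def eigenvector_def)
  define q where "q = (\<Sum>i<m. \<Sum>j<m. cnj (v $ i) * A $$ (i,j) * v $ j)"
  define s where "s = (\<Sum>i<m. (cmod (v $ i))\<^sup>2)"
  obtain i where "i < m" "v $ i \<noteq> 0" using nonzero_vec_has_nonzero_entry[OF v(1,2)] .
  then have "s > 0" unfolding s_def by (intro sum_pos2[of _ i]) auto
  have "q = (\<Sum>i<m. cnj (v $ i) * (A *\<^sub>v v) $ i)"
    unfolding q_def using carrier v(1)
    by (auto simp: mult_mat_vec_entry sum_distrib_left mult.assoc simp del: index_mult_mat_vec)
  also have "\<dots> = x * of_real s"
    unfolding v(3) s_def of_real_sum complex_norm_square sum_distrib_left using v(1)
    by (intro sum.cong) auto
  finally have q: "q = x * of_real s" .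
  have "cnj q = (\<Sum>i<m. \<Sum>j<m. cnj (v $ j) * A $$ (j,i) * v $ i)"
    unfolding q_def cnj_sum using density_op_hermitian[OF A]
    by (intro sum.cong refl) (simp add: mult_ac)
  also have "\<dots> = q" unfolding q_def by (rule sum.swap)
  finally have "cnj x = x" using \<open>s > 0\<close> by (simp add: q)
  then show "x = of_real (Re x)" by (simp add: complex_eq_iff)
  have "0 \<le> Re q" unfolding q_def by (rule density_op_nonneg[OF A])
  then have "0 \<le> Re x * s" by (simp add: q)
  then show "0 \<le> Re x" using \<open>s > 0\<close> by (simp add: zero_le_mult_iff)
qed

definition purity :: "nat \<Rightarrow> complex mat \<Rightarrow> real" where
  "purity m A = (\<Sum>i<m. \<Sum>j<m. (cmod (A $$ (i,j)))\<^sup>2)"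

lemma trace_square_density_op:
  assumes A: "density_op m A"
  shows "trace (A * A) = of_real (purity m A)"
proof -
  note carrier = density_op_carrier[OF A]
  have "trace (A * A) = (\<Sum>i<m. \<Sum>j<m. A $$ (i,j) * A $$ (j,i))"
    unfolding trace_def using carrier
    by (auto simp: mult_mat_entry[OF carrier carrier] simp del: index_mult_mat(1))
  also have "\<dots> = of_real (purity m A)"
    unfolding purity_def of_real_sum complex_norm_square using density_op_hermitian[OF A]
    by (intro sum.cong refl) simp
  finally show ?thesis .
qed

lemma density_op_spectrum:
  assumes A: "density_op m A"
  obtains ps where "prob_list ps" "length ps = m"
    "(\<Sum>p\<leftarrow>ps. p\<^sup>2) = purity m A" "vn_entropy A = shannon_entropy ps"
proof -
  note carrier = density_op_carrier[OF A]
  obtain as where as: "char_poly A = (\<Prod>a\<leftarrow>as. [:- a, 1:])" "length as = m"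
    using char_poly_factorized[OF carrier] by auto
  define ps where "ps = map Re as"
  have eig: "x = of_real (Re x) \<and> 0 \<le> Re x" if "x \<in> set as" for x
  proof -
    have "poly (char_poly A) x = 0" unfolding as(1) using that by (induction as) auto
    then have "eigenvalue A x" using eigenvalue_root_char_poly[OF carrier] by simp
    with density_op_eigenvalue[OF A] show ?thesis by blast
  qed
  then have as_eq: "as = map of_real ps" unfolding ps_def by (simp add: map_idI)
  note traces = trace_char_poly_roots[OF carrier as(1)]
  have "complex_of_real (sum_list ps) = sum_list as"
    unfolding as_eq by (induction ps) auto
  then have "sum_list ps = 1"
    using traces(1) trace_density_op[OF A] by (simp add: of_real_eq_1_iff)
  then have "prob_list ps" using eig by (auto simp: prob_list_def ps_def)
  have "complex_of_real (\<Sum>p\<leftarrow>ps. p\<^sup>2) = (\<Sum>a\<leftarrow>as. a\<^sup>2)"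
    unfolding as_eq by (induction ps) auto
  also have "\<dots> = of_real (purity m A)"
    using traces(2) trace_square_density_op[OF A] by simp
  finally have "(\<Sum>p\<leftarrow>ps. p\<^sup>2) = purity m A" by (simp only: of_real_eq_iff)
  with \<open>prob_list ps\<close> show ?thesis
    using that[of ps] as vn_entropy_char_poly_roots[OF as(1)] by (simp add: ps_def)
qed

lemma purity_le_1:
  assumes "density_op m A"
  shows "purity m A \<le> 1"
  using density_op_spectrum[OF assms] sum_squares_prob_list_le_1 by metis

lemma vn_entropy_ge_1_minus_purity:
  assumes "density_op m A"
  shows "1 - purity m A \<le> vn_entropy A"
  using density_op_spectrum[OF assms] shannon_entropy_ge_1_minus_sum_squares by metis

lemma vn_entropy_nonneg:
  assumes "density_op m A"
  shows "0 \<le> vn_entropy A"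
  using purity_le_1[OF assms] vn_entropy_ge_1_minus_purity[OF assms] by simp

lemma vn_entropy_eq_0_if_purity_eq_1:
  assumes "density_op m A" "purity m A = 1"
  shows "vn_entropy A = 0"
  using density_op_spectrum[OF assms(1)] shannon_entropy_eq_0 assms(2) by metis

lemma vn_entropy_le_ln_dim:
  assumes "density_op m A"
  shows "vn_entropy A \<le> ln (real m)"
  using density_op_spectrum[OF assms] shannon_entropy_le_ln_length by metis

lemma vn_entropy_maximally_mixed:
  assumes "m > 0"
  shows "vn_entropy (of_real (1 / real m) \<cdot>\<^sub>m 1\<^sub>m m) = ln (real m)"
proof -
  let ?A = "of_real (1 / real m) \<cdot>\<^sub>m 1\<^sub>m m :: complex mat"
  have "char_poly ?A = (\<Prod>a\<leftarrow>diag_mat ?A. [:- a, 1:])"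
    by (rule char_poly_upper_triangular[of _ m]) (auto intro!: upper_triangularI)
  then have "vn_entropy ?A = shannon_entropy (map Re (diag_mat ?A))"
    by (rule vn_entropy_char_poly_roots)
  also have "map Re (diag_mat ?A) = map (\<lambda>_. 1 / real m) [0..<m]" by (auto simp: diag_mat_def)
  also have "shannon_entropy \<dots> = ln (real m)"
    using assms by (simp add: shannon_entropy_def o_def sum_list_triv ln_div)
  finally show ?thesis .
qed

section \<open>Pure states and mixtures\<close>

definition pure_state :: "nat \<Rightarrow> complex vec \<Rightarrow> bool" where
  "pure_state m v \<longleftrightarrow> v \<in> carrier_vec m \<and> (\<Sum>i<m. (cmod (v $ i))\<^sup>2) = 1"

lemma pure_state_carrier: "pure_state m v \<Longrightarrow> v \<in> carrier_vec m"
  by (simp add: pure_state_def)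

lemma pure_state_neq_0: "pure_state m v \<Longrightarrow> v \<noteq> 0\<^sub>v m"
  by (auto simp: pure_state_def)

lemma normalize_pure_state:
  assumes v: "v \<in> carrier_vec m" "v \<noteq> 0\<^sub>v m"
  obtains c where "pure_state m (c \<cdot>\<^sub>v v)"
proof -
  define s where "s = (\<Sum>i<m. (cmod (v $ i))\<^sup>2)"
  obtain i where "i < m" "v $ i \<noteq> 0" using nonzero_vec_has_nonzero_entry[OF v] .
  then have "s > 0" unfolding s_def by (intro sum_pos2[of _ i]) auto
  define c where "c = complex_of_real (1 / sqrt s)"
  have "(cmod c)\<^sup>2 = 1 / s" using \<open>s > 0\<close> by (simp add: c_def norm_divide power_divide)
  then have "(\<Sum>i<m. (cmod ((c \<cdot>\<^sub>v v) $ i))\<^sup>2) = 1 / s * s"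
    using v unfolding s_def sum_distrib_left
    by (intro sum.cong) (auto simp: norm_mult power_mult_distrib)
  then show ?thesis using that[of c] v(1) \<open>s > 0\<close> by (simp add: pure_state_def)
qed

lemma cmod_inner_eq_1_iff:
  assumes u: "pure_state m u" and v: "pure_state m v"
  shows "cmod (\<Sum>i<m. u $ i * cnj (v $ i)) = 1 \<longleftrightarrow> (\<exists>c. u = c \<cdot>\<^sub>v v)"
proof -
  define a where "a = (\<Sum>i<m. u $ i * cnj (v $ i))"
  have dim: "dim_vec u = m" "dim_vec v = m" using u v by (auto simp: pure_state_def)
  have u1: "(\<Sum>i<m. u $ i * cnj (u $ i)) = 1" and v1: "(\<Sum>i<m. v $ i * cnj (v $ i)) = 1"
    using u v unfolding pure_state_def complex_norm_square[symmetric] of_real_sum[symmetric] by simp_all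
  have "of_real (\<Sum>i<m. (cmod (u $ i - a * v $ i))\<^sup>2)
      = (\<Sum>i<m. u $ i * cnj (u $ i) - cnj a * (u $ i * cnj (v $ i))
          - a * cnj (u $ i * cnj (v $ i)) + a * cnj a * (v $ i * cnj (v $ i)))"
    unfolding of_real_sum complex_norm_square
    by (intro sum.cong refl) (simp add: algebra_simps)
  also have "\<dots> = (\<Sum>i<m. u $ i * cnj (u $ i)) - cnj a * a - a * cnj a
      + a * cnj a * (\<Sum>i<m. v $ i * cnj (v $ i))"
    unfolding a_def cnj_sum by (simp only: sum.distrib sum_subtractf sum_distrib_left)
  also have "\<dots> = of_real (1 - (cmod a)\<^sup>2)"
    unfolding u1 v1 of_real_diff complex_norm_square by (simp add: mult.commute)
  finally have defect: "(\<Sum>i<m. (cmod (u $ i - a * v $ i))\<^sup>2) = 1 - (cmod a)\<^sup>2"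
    by (simp only: of_real_eq_iff)
  have "\<exists>c. u = c \<cdot>\<^sub>v v" if "cmod a = 1"
  proof -
    have "(\<Sum>i<m. (cmod (u $ i - a * v $ i))\<^sup>2) = 0" unfolding defect that by simp
    then have "u = a \<cdot>\<^sub>v v" using dim by (auto simp: sum_nonneg_eq_0_iff intro!: eq_vecI)
    then show ?thesis ..
  qed
  moreover have "cmod a = 1" if "u = c \<cdot>\<^sub>v v" for c
  proof -
    have "a = c * (\<Sum>i<m. v $ i * cnj (v $ i))"
      unfolding a_def sum_distrib_left using dim by (intro sum.cong) (auto simp: that)
    then have "1 - (cmod a)\<^sup>2 = 0" unfolding defect[symmetric] v1 using dim by (simp add: that)
    then show ?thesis using norm_ge_zero[of a] by (simp add: power2_eq_1_iff)
  qed
  ultimately show ?thesis unfolding a_def[symmetric] by blast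
qed

lemma outer_entry: "v \<in> carrier_vec m \<Longrightarrow> i < m \<Longrightarrow> j < m \<Longrightarrow> outer v $$ (i,j) = v $ i * cnj (v $ j)"
  by (simp add: outer_def)

lemma density_op_outer:
  assumes "pure_state m v"
  shows "density_op m (outer v)"
  unfolding density_op_iff
proof (intro conjI allI impI)
  have v: "v \<in> carrier_vec m" and unit: "(\<Sum>i<m. (cmod (v $ i))\<^sup>2) = 1"
    using assms by (auto simp: pure_state_def)
  show "outer v \<in> carrier_mat m m" using v by (simp add: outer_def)
  have "trace (outer v) = of_real (\<Sum>i<m. (cmod (v $ i))\<^sup>2)"
    unfolding trace_def of_real_sum complex_norm_square using v
    by (auto simp: outer_def)
  then show "trace (outer v) = 1" using unit by simp
  show "cnj (outer v $$ (j,i)) = outer v $$ (i,j)" if "i < m" "j < m" for i j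
    using that by (simp add: outer_entry[OF v])
  fix f :: "nat \<Rightarrow> complex"
  define z where "z = (\<Sum>j<m. cnj (v $ j) * f j)"
  have "(\<Sum>i<m. \<Sum>j<m. cnj (f i) * outer v $$ (i,j) * f j) = cnj z * z"
    unfolding z_def cnj_sum sum_product
    by (intro sum.cong refl) (simp add: outer_entry[OF v] mult_ac)
  also have "\<dots> = of_real ((cmod z)\<^sup>2)" by (simp only: complex_norm_square mult.commute)
  finally show "0 \<le> Re (\<Sum>i<m. \<Sum>j<m. cnj (f i) * outer v $$ (i,j) * f j)" by simp
qed

lemma purity_outer:
  assumes "pure_state m v"
  shows "purity m (outer v) = 1"
proof -
  have v: "v \<in> carrier_vec m" and unit: "(\<Sum>i<m. (cmod (v $ i))\<^sup>2) = 1"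
    using assms by (auto simp: pure_state_def)
  have "purity m (outer v) = (\<Sum>i<m. (cmod (v $ i))\<^sup>2) * (\<Sum>i<m. (cmod (v $ i))\<^sup>2)"
    unfolding purity_def sum_product
    by (intro sum.cong refl) (simp add: outer_entry[OF v] norm_mult power_mult_distrib)
  then show ?thesis by (simp add: unit)
qed

definition mixture :: "nat \<Rightarrow> nat \<Rightarrow> (nat \<Rightarrow> real) \<Rightarrow> (nat \<Rightarrow> complex mat) \<Rightarrow> complex mat" where
  "mixture m k p M = mat m m (\<lambda>(r,c). \<Sum>i<k. complex_of_real (p i) * M i $$ (r,c))"

lemma density_op_mixture:
  assumes M: "\<forall>i<k. 0 \<le> p i \<and> density_op m (M i)" and p: "(\<Sum>i<k. p i) = 1"
  shows "density_op m (mixture m k p M)"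
  unfolding density_op_iff
proof (intro conjI allI impI)
  have "trace (mixture m k p M) = (\<Sum>r<m. \<Sum>i<k. complex_of_real (p i) * M i $$ (r,r))"
    by (simp add: trace_def mixture_def)
  also have "\<dots> = (\<Sum>i<k. complex_of_real (p i) * (\<Sum>r<m. M i $$ (r,r)))"
    unfolding sum_distrib_left by (rule sum.swap)
  also have "\<dots> = (\<Sum>i<k. complex_of_real (p i) * trace (M i))"
    using M by (intro sum.cong refl) (auto simp: trace_def dest!: density_op_carrier)
  also have "\<dots> = (\<Sum>i<k. complex_of_real (p i))"
    using M by (intro sum.cong refl) (auto dest!: trace_density_op)
  finally show "trace (mixture m k p M) = 1" by (simp add: p flip: of_real_sum)
  show "cnj (mixture m k p M $$ (j,i)) = mixture m k p M $$ (i,j)" if "i < m" "j < m" for i j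
    using that M density_op_hermitian[of m _ i j] by (simp add: mixture_def)
  fix f :: "nat \<Rightarrow> complex"
  have Re_scale: "Re (complex_of_real c * z) = c * Re z" for c z by simp
  let ?q = "\<lambda>A. \<Sum>r<m. \<Sum>s<m. cnj (f r) * A $$ (r,s) * f s"
  have "?q (mixture m k p M)
      = (\<Sum>r<m. \<Sum>s<m. \<Sum>i<k. complex_of_real (p i) * (cnj (f r) * M i $$ (r,s) * f s))"
    by (intro sum.cong refl) (simp add: mixture_def sum_distrib_left sum_distrib_right mult_ac)
  also have "\<dots> = (\<Sum>r<m. \<Sum>i<k. \<Sum>s<m. complex_of_real (p i) * (cnj (f r) * M i $$ (r,s) * f s))"
    by (intro sum.cong refl sum.swap)
  also have "\<dots> = (\<Sum>i<k. complex_of_real (p i) * ?q (M i))"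
    unfolding sum_distrib_left by (rule sum.swap)
  finally have "Re (?q (mixture m k p M)) = (\<Sum>i<k. p i * Re (?q (M i)))"
    by (simp only: Re_sum Re_scale)
  also have "0 \<le> \<dots>" using M by (intro sum_nonneg mult_nonneg_nonneg density_op_nonneg) auto
  finally show "0 \<le> Re (?q (mixture m k p M))" .
qed (simp add: mixture_def)

section \<open>Holevo capacity\<close>

definition ensemble :: "nat \<Rightarrow> nat \<Rightarrow> (nat \<Rightarrow> real) \<Rightarrow> (nat \<Rightarrow> complex mat) \<Rightarrow> bool" where
  "ensemble m k p \<rho> \<longleftrightarrow> 0 < k \<and> (\<forall>i<k. 0 \<le> p i \<and> density_op m (\<rho> i)) \<and> (\<Sum>i<k. p i) = 1"

definition holevo_quantity :: "nat \<Rightarrow> nat \<Rightarrow> (nat \<Rightarrow> real) \<Rightarrow> (nat \<Rightarrow> complex mat) \<Rightarrow> real" where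
  "holevo_quantity m k p \<rho> = vn_entropy (mixture m k p \<rho>) - (\<Sum>i<k. p i * vn_entropy (\<rho> i))"

lemma holevo_quantity_le_mixture_entropy:
  assumes "ensemble m k p \<rho>"
  shows "holevo_quantity m k p \<rho> \<le> vn_entropy (mixture m k p \<rho>)"
  using assms vn_entropy_nonneg
  by (auto simp: holevo_quantity_def ensemble_def intro!: sum_nonneg mult_nonneg_nonneg)

lemma vn_entropy_mixture_le_ln_dim:
  assumes "ensemble m k p \<rho>"
  shows "vn_entropy (mixture m k p \<rho>) \<le> ln (real m)"
  using assms unfolding ensemble_def by (intro vn_entropy_le_ln_dim density_op_mixture) auto

lemma ensemble_has_small_entropy_member:
  assumes en: "ensemble m k p \<rho>" and "ln (real m) - \<epsilon> < holevo_quantity m k p \<rho>"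
  obtains i where "i < k" "vn_entropy (\<rho> i) < \<epsilon>"
proof -
  have p: "\<And>i. i < k \<Longrightarrow> 0 \<le> p i" "(\<Sum>i<k. p i) = 1" using en by (auto simp: ensemble_def)
  have "\<exists>i<k. vn_entropy (\<rho> i) < \<epsilon>"
  proof (rule ccontr)
    assume "\<not> ?thesis"
    then have "\<epsilon> \<le> vn_entropy (\<rho> i)" if "i < k" for i using that by (meson not_less)
    then have "(\<Sum>i<k. p i * \<epsilon>) \<le> (\<Sum>i<k. p i * vn_entropy (\<rho> i))"
      using p(1) by (intro sum_mono mult_left_mono) auto
    moreover have "(\<Sum>i<k. p i * \<epsilon>) = \<epsilon>" using p(2) by (simp flip: sum_distrib_right)
    ultimately show False
      using assms(2) vn_entropy_mixture_le_ln_dim[OF en] by (simp add: holevo_quantity_def)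
  qed
  then show ?thesis using that by blast
qed

locale state_channel =
  fixes m :: nat and E :: "complex mat \<Rightarrow> complex mat"
  assumes density_op_channel: "density_op m \<rho> \<Longrightarrow> density_op m (E \<rho>)"
begin

lemma ensemble_channel: "ensemble m k p \<rho> \<Longrightarrow> ensemble m k p (\<lambda>i. E (\<rho> i))"
  by (simp add: ensemble_def density_op_channel)

definition achievable_rates :: "real set" where
  "achievable_rates = {holevo_quantity m k p (\<lambda>i. E (\<rho> i)) | k p \<rho>. ensemble m k p \<rho>}"

lemma achievable_ratesI:
  "ensemble m k p \<rho> \<Longrightarrow> holevo_quantity m k p (\<lambda>i. E (\<rho> i)) \<in> achievable_rates"
  unfolding achievable_rates_def by (intro CollectI exI[of _ k] exI[of _ p] exI[of _ \<rho>]) simp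

lemma achievable_ratesE:
  assumes "x \<in> achievable_rates"
  obtains k p \<rho> where "ensemble m k p \<rho>" "x = holevo_quantity m k p (\<lambda>i. E (\<rho> i))"
  using assms unfolding achievable_rates_def by (elim CollectE exE conjE)

lemma holevo_capacity_eq: "holevo_capacity m E = Sup achievable_rates"
proof -
  have "(let M = (\<lambda>i. E (\<rho> i)) in
        mat (dim_row (M 0)) (dim_col (M 0)) (\<lambda>(r,c). \<Sum>i<k. complex_of_real (p i) * M i $$ (r,c)))
      = mixture m k p (\<lambda>i. E (\<rho> i))"
    if "0 < k \<and> (\<forall>i<k. 0 \<le> p i \<and> density_op m (\<rho> i)) \<and> (\<Sum>i<k. p i) = 1" for k p \<rho>
  proof -
    have "E (\<rho> 0) \<in> carrier_mat m m" using that by (intro density_op_carrier density_op_channel) simp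
    then show ?thesis by (simp add: mixture_def)
  qed
  then show ?thesis
    unfolding holevo_capacity_def achievable_rates_def holevo_quantity_def ensemble_def
    by (intro arg_cong[where f = Sup] Collect_cong ex_cong1 rev_conj_cong[OF refl]) simp
qed

lemma achievable_rates_le_ln_dim:
  assumes "x \<in> achievable_rates"
  shows "x \<le> ln (real m)"
  using assms
proof (rule achievable_ratesE)
  fix k p \<rho> assume "ensemble m k p \<rho>" and x: "x = holevo_quantity m k p (\<lambda>i. E (\<rho> i))"
  then have en: "ensemble m k p (\<lambda>i. E (\<rho> i))" by (intro ensemble_channel)
  show ?thesis
    unfolding x using holevo_quantity_le_mixture_entropy[OF en] vn_entropy_mixture_le_ln_dim[OF en]
    by (rule order_trans)
qed

lemma maximal_holevo_capacity_nearly_pure_output: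
  assumes cap: "holevo_capacity m E = ln (real m)" and "\<epsilon> > 0" and \<rho>0: "density_op m \<rho>0"
  obtains \<rho> where "density_op m \<rho>" "purity m (E \<rho>) > 1 - \<epsilon>"
proof -
  have "ensemble m 1 (\<lambda>_. 1) (\<lambda>_. \<rho>0)" using \<rho>0 by (simp add: ensemble_def)
  then have "achievable_rates \<noteq> {}" using achievable_ratesI by blast
  moreover have "ln (real m) - \<epsilon> < Sup achievable_rates"
    using cap \<open>\<epsilon> > 0\<close> by (simp add: holevo_capacity_eq)
  ultimately obtain x where "x \<in> achievable_rates" "ln (real m) - \<epsilon> < x"
    using less_cSupD by blast
  then obtain k p \<rho> where en: "ensemble m k p \<rho>"
    and big: "ln (real m) - \<epsilon> < holevo_quantity m k p (\<lambda>i. E (\<rho> i))"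
    by (auto elim: achievable_ratesE)
  obtain i where i: "i < k" "vn_entropy (E (\<rho> i)) < \<epsilon>"
    using ensemble_has_small_entropy_member[OF ensemble_channel[OF en] big] .
  have "density_op m (\<rho> i)" using en i(1) by (simp add: ensemble_def)
  moreover from vn_entropy_ge_1_minus_purity[OF density_op_channel[OF this]] i(2)
  have "purity m (E (\<rho> i)) > 1 - \<epsilon>" by simp
  ultimately show ?thesis by (rule that)
qed

lemma maximal_holevo_capacityI:
  assumes J: "finite J" "J \<noteq> {}" and \<rho>: "\<And>j. j \<in> J \<Longrightarrow> density_op m (\<rho> j)"
    and pure: "\<And>j. j \<in> J \<Longrightarrow> purity m (E (\<rho> j)) = 1"
    and mixed: "\<And>r s. r < m \<Longrightarrow> s < m \<Longrightarrow>
      (\<Sum>j\<in>J. E (\<rho> j) $$ (r,s)) = (if r = s then of_nat (card J) / of_nat m else 0)"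
  shows "holevo_capacity m E = ln (real m)"
proof -
  obtain h where h: "bij_betw h {..<card J} J"
    using ex_bij_betw_nat_finite[OF J(1)] by (auto simp: atLeast0LessThan)
  have card: "card J > 0" using J by (simp add: card_gt_0_iff)
  define p where "p = (\<lambda>_ :: nat. 1 / real (card J))"
  have en: "ensemble m (card J) p (\<rho> \<circ> h)"
    using card \<rho> bij_betwE[OF h] by (simp add: ensemble_def p_def)
  obtain j where j: "j \<in> J" using J(2) by blast
  have "m > 0"
    using trace_density_op[OF \<rho>[OF j]] density_op_carrier[OF \<rho>[OF j]] by (cases m) (auto simp: trace_def)
  have "(\<Sum>i<card J. complex_of_real (p i) * E (\<rho> (h i)) $$ (r,s))
      = of_real (1 / real (card J)) * (\<Sum>j\<in>J. E (\<rho> j) $$ (r,s))" for r s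
    by (simp add: p_def sum_distrib_left sum.reindex_bij_betw[OF h, symmetric])
  then have "mixture m (card J) p (\<lambda>i. E ((\<rho> \<circ> h) i)) = of_real (1 / real m) \<cdot>\<^sub>m 1\<^sub>m m"
    using card by (intro eq_matI) (auto simp: mixture_def mixed)
  moreover have "vn_entropy (E ((\<rho> \<circ> h) i)) = 0" if "i < card J" for i
    using that \<rho> pure bij_betwE[OF h]
    by (intro vn_entropy_eq_0_if_purity_eq_1[of m] density_op_channel) auto
  ultimately have "holevo_quantity m (card J) p (\<lambda>i. E ((\<rho> \<circ> h) i)) = ln (real m)"
    using vn_entropy_maximally_mixed[OF \<open>m > 0\<close>] by (simp add: holevo_quantity_def)
  then have "ln (real m) \<in> achievable_rates" using achievable_ratesI[OF en] by simp
  then show ?thesis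
    unfolding holevo_capacity_eq using achievable_rates_le_ln_dim by (rule cSup_eq_maximum)
qed

end

section \<open>Digits and residues\<close>

lemma mult_add_less:
  fixes x y k l :: nat
  assumes "x < k" "y < l"
  shows "x * l + y < k * l"
proof -
  have "x * l + y < Suc x * l" using assms(2) by simp
  also have "\<dots> \<le> k * l" using assms(1) by (intro mult_right_mono) auto
  finally show ?thesis .
qed

lemma mod_add_mult_mod_eq:
  fixes x y z m :: int
  shows "(x + y * (z mod m)) mod m = (x + y * z) mod m" "(y * (z mod m) + x) mod m = (y * z + x) mod m"
  by (metis mod_add_right_eq mod_mult_right_eq) (metis mod_add_left_eq mod_mult_right_eq)

lemma digit_less: "d > 0 \<Longrightarrow> digit d k i < d"
  by (simp add: digit_def)

lemma digit_0 [simp]: "digit d k 0 = 0"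
  by (simp add: digit_def)

lemma enc_Suc: "enc d (Suc n) f = nat (f n mod int d) * d ^ n + enc d n f"
  by (simp add: enc_def)

lemma enc_less:
  assumes "d > 0"
  shows "enc d n f < d ^ n"
proof (induction n)
  case (Suc n)
  have "Suc (nat (f n mod int d)) \<le> d" using assms by (simp add: Suc_le_eq nat_less_iff)
  then have "Suc (nat (f n mod int d)) * d ^ n \<le> d * d ^ n" by (rule mult_right_mono) simp
  then show ?case using Suc by (simp add: enc_Suc)
qed (simp add: enc_def)

lemma digit_enc:
  assumes "d > 0" "k < n"
  shows "digit d k (enc d n f) = nat (f k mod int d)"
  using assms(2)
proof (induction n)
  case (Suc n)
  show ?case
  proof (cases "k = n")
    case True
    have "nat (f n mod int d) < d" using assms(1) by (simp add: nat_less_iff)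
    then show ?thesis using True assms(1) enc_less[of d n f] by (simp add: enc_Suc digit_def)
  next
    case False
    then have k: "k < n" using Suc.prems by simp
    then have "d ^ n = d ^ k * (d * d ^ (n - Suc k))"
      by (simp only: flip: power_add power_Suc) simp
    then have "enc d (Suc n) f = d ^ k * (d * (nat (f n mod int d) * d ^ (n - Suc k))) + enc d n f"
      by (simp add: enc_Suc)
    then have "digit d k (enc d (Suc n) f) = digit d k (enc d n f)"
      using assms(1) by (simp only: digit_def div_mult_self3) simp
    then show ?thesis using Suc.IH[OF k] by simp
  qed
qed simp

lemma enc_digit: "enc d n (\<lambda>k. int (digit d k i)) = i mod d ^ n"
proof (induction n)
  case (Suc n)
  have "enc d (Suc n) (\<lambda>k. int (digit d k i)) = digit d n i * d ^ n + i mod d ^ n"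
    using Suc by (simp add: enc_Suc digit_def flip: zmod_int)
  also have "\<dots> = i mod (d ^ n * d)" by (simp add: mod_mult2_eq digit_def)
  finally show ?case by (simp add: mult.commute)
qed (simp add: enc_def)

lemma inv_mod_cong:
  assumes "d > 0" "coprime a (int d)"
  shows "[inv_mod d a * a = 1] (mod int d)"
proof -
  obtain b where "[a * b = 1] (mod int d)" using cong_solve_coprime_int[OF assms(2)] by blast
  then have "[b mod int d * a = 1] (mod int d)" by (simp add: cong_def mod_simps mult.commute)
  then have "\<exists>b. 0 \<le> b \<and> b < int d \<and> [b * a = 1] (mod int d)"
    using assms(1) by (intro exI[of _ "b mod int d"]) simp
  from someI_ex[OF this] show ?thesis by (simp add: inv_mod_def)
qed

lemma coprime_inv_mod:
  assumes "d > 0" "coprime a (int d)"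
  shows "coprime (inv_mod d a) (int d)"
  using cong_imp_coprime[OF cong_sym[OF inv_mod_cong[OF assms]]] by simp

section \<open>Characters\<close>

lemma chi_0 [simp]: "chi d 0 = 1"
  by (simp add: chi_def)

lemma chi_add: "chi d (x + y) = chi d x * chi d y"
  by (simp add: chi_def cis_mult ring_distribs add_divide_distrib)

lemma chi_sum: "chi d (\<Sum>k\<in>K. f k) = (\<Prod>k\<in>K. chi d (f k))"
  by (induction K rule: infinite_finite_induct) (simp_all add: chi_add)

lemma chi_mult: "chi d (k * x) = chi d x powi k"
  by (simp add: chi_def cis_power_int mult_ac)

lemma norm_chi [simp]: "cmod (chi d x) = 1"
  by (simp add: chi_def)

lemma chi_eq_1_iff:
  assumes "d > 0"
  shows "chi d x = 1 \<longleftrightarrow> int d dvd x"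
proof
  assume "chi d x = 1"
  then have "cos (2 * pi * of_int x / of_nat d) = 1"
    by (metis chi_def cis.sel(1) one_complex.sel(1))
  then obtain m :: int where "2 * pi * of_int x / of_nat d = of_int m * 2 * pi"
    using cos_one_2pi_int by blast
  then have "real_of_int x = of_int (m * int d)" using assms by (simp add: field_simps)
  then have "x = m * int d" using of_int_eq_iff by blast
  then show "int d dvd x" by simp
next
  assume "int d dvd x"
  then obtain m where "x = int d * m" by auto
  then have "2 * pi * of_int x / of_nat d = 2 * pi * of_int m" using assms by simp
  then show "chi d x = 1" unfolding chi_def by (simp add: cis_multiple_2pi)
qed

lemma chi_cong:
  assumes "d > 0" "[x = y] (mod int d)"
  shows "chi d x = chi d y"
proof -
  have "chi d (x - y) = 1" using assms by (simp add: chi_eq_1_iff cong_iff_dvd_diff)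
  then show ?thesis using chi_add[of d "x - y" y] by simp
qed

section \<open>Arithmetic of labels\<close>

locale qudits =
  fixes d n :: nat
  assumes d_pos [simp]: "d > 0"
begin

abbreviation D where "D \<equiv> d ^ n"

definition lin_comb :: "int \<Rightarrow> nat \<Rightarrow> int \<Rightarrow> nat \<Rightarrow> nat" where
  "lin_comb \<alpha> a \<beta> b = enc d n (\<lambda>k. \<alpha> * int (digit d k a) + \<beta> * int (digit d k b))"

abbreviation vscale where "vscale \<alpha> a \<equiv> lin_comb \<alpha> a 0 0"
abbreviation vsub where "vsub a b \<equiv> lin_comb 1 a (- 1) b"

lemma vadd_eq_lin_comb: "vadd d n a b = lin_comb 1 a 1 b"
  by (simp add: vadd_def lin_comb_def)

lemma lin_comb_less [simp]: "lin_comb \<alpha> a \<beta> b < D"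
  by (simp add: lin_comb_def enc_less)

lemma digit_lin_comb:
  "k < n \<Longrightarrow> int (digit d k (lin_comb \<alpha> a \<beta> b))
    = (\<alpha> * int (digit d k a) + \<beta> * int (digit d k b)) mod int d"
  by (simp add: lin_comb_def digit_enc)

lemma label_eqI:
  assumes "a < D" "b < D" "\<And>k. k < n \<Longrightarrow> int (digit d k a) mod int d = int (digit d k b) mod int d"
  shows "a = b"
proof -
  have "enc d n (\<lambda>k. int (digit d k a)) = enc d n (\<lambda>k. int (digit d k b))"
    using assms(3) by (simp add: enc_def)
  then show ?thesis using assms(1,2) by (simp add: enc_digit)
qed

lemmas label_simps = digit_lin_comb mod_add_mult_mod_eq mod_simps

lemma lin_comb_cong:
  assumes "[\<alpha> = \<alpha>'] (mod int d)" "[\<beta> = \<beta>'] (mod int d)"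
  shows "lin_comb \<alpha> a \<beta> b = lin_comb \<alpha>' a \<beta>' b"
proof -
  have "[\<alpha> * x + \<beta> * y = \<alpha>' * x + \<beta>' * y] (mod int d)" for x y
    using assms by (intro cong_add cong_mult) auto
  then show ?thesis by (simp add: lin_comb_def enc_def cong_def)
qed

lemma lin_comb_1_0: "a < D \<Longrightarrow> lin_comb 1 a 0 b = a"
  and lin_comb_0_1: "b < D \<Longrightarrow> lin_comb 0 a 1 b = b"
  by (simp_all add: lin_comb_def enc_digit)

lemma lin_comb_lin_comb:
  "lin_comb \<alpha> (lin_comb \<alpha>1 a \<beta>1 b) \<beta> (lin_comb \<alpha>2 a \<beta>2 b)
    = lin_comb (\<alpha> * \<alpha>1 + \<beta> * \<alpha>2) a (\<alpha> * \<beta>1 + \<beta> * \<beta>2) b"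
  by (rule label_eqI; simp add: label_simps; simp add: algebra_simps)

lemma lin_comb_lin_comb_left: "lin_comb \<alpha> (lin_comb \<alpha>1 a \<beta>1 b) \<beta> b = lin_comb (\<alpha> * \<alpha>1) a (\<alpha> * \<beta>1 + \<beta>) b"
  by (rule label_eqI; simp add: label_simps; simp add: algebra_simps)

lemma vscale_vscale: "vscale \<alpha> (vscale \<beta> a) = vscale (\<alpha> * \<beta>) a"
  using lin_comb_lin_comb_left[of \<alpha> \<beta> a 0 0 0] by simp

lemma lin_comb_vsub: "lin_comb \<alpha> (vsub a q) \<beta> b = vsub (lin_comb \<alpha> a \<beta> b) (vscale \<alpha> q)"
  by (rule label_eqI; simp add: label_simps; simp add: algebra_simps)

lemma vsub_vadd: "vsub r (vadd d n q q') = vsub (vsub r q) q'"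
  unfolding vadd_eq_lin_comb by (rule label_eqI; simp add: label_simps; simp add: algebra_simps)

lemma lin_comb_left_inverse:
  assumes "coprime \<alpha> (int d)" "a < D"
  shows "lin_comb (inv_mod d \<alpha>) (lin_comb \<alpha> a \<beta> b) (- (inv_mod d \<alpha> * \<beta>)) b = a"
  using lin_comb_cong[OF inv_mod_cong[OF d_pos assms(1)] cong_refl[of 0]] assms(2)
  by (simp add: lin_comb_lin_comb_left lin_comb_1_0)

lemma vscale_inv_mod:
  assumes "coprime \<alpha> (int d)" "a < D"
  shows "vscale \<alpha> (vscale (inv_mod d \<alpha>) a) = a"
proof -
  have "vscale (inv_mod d \<alpha> * \<alpha>) a = vscale 1 a"
    using inv_mod_cong[OF d_pos assms(1)] by (rule lin_comb_cong) simp
  then show ?thesis using assms(2) by (simp add: vscale_vscale lin_comb_1_0 mult.commute)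
qed

lemma bij_betw_lin_comb:
  assumes "coprime \<alpha> (int d)"
  shows "bij_betw (\<lambda>a. lin_comb \<alpha> a \<beta> b) {..<D} {..<D}"
proof -
  have "inj_on (\<lambda>a. lin_comb \<alpha> a \<beta> b) {..<D}"
    by (rule inj_on_inverseI, rule lin_comb_left_inverse[OF assms]) simp
  moreover from this have "(\<lambda>a. lin_comb \<alpha> a \<beta> b) ` {..<D} = {..<D}"
    by (intro endo_inj_surj) auto
  ultimately show ?thesis by (rule bij_betw_imageI)
qed

lemma lin_comb_commute: "lin_comb \<alpha> a \<beta> b = lin_comb \<beta> b \<alpha> a"
  by (simp add: lin_comb_def add.commute)

lemma sum_lin_comb_left:
  "coprime \<alpha> (int d) \<Longrightarrow> (\<Sum>a<D. F (lin_comb \<alpha> a \<beta> b)) = (\<Sum>a<D. F a)"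
  by (rule sum.reindex_bij_betw[OF bij_betw_lin_comb])

lemma sum_lin_comb_right:
  "coprime \<beta> (int d) \<Longrightarrow> (\<Sum>b<D. F (lin_comb \<alpha> a \<beta> b)) = (\<Sum>b<D. F b)"
  unfolding lin_comb_commute[of \<alpha>] by (rule sum_lin_comb_left)

lemma sum_vscale:
  assumes "coprime \<alpha> (int d)" "coprime \<beta> (int d)"
  shows "(\<Sum>p<D. \<Sum>q<D. F (vscale \<alpha> p) (vscale \<beta> q)) = (\<Sum>p<D. \<Sum>q<D. F p q)"
  by (simp only: sum_lin_comb_left[OF assms(2), of "F _"]
      sum_lin_comb_left[OF assms(1), of "\<lambda>p. \<Sum>q<D. F p q"])

definition pairing :: "nat \<Rightarrow> nat \<Rightarrow> complex" where
  "pairing p r = chi d (\<Sum>k<n. int (digit d k p) * int (digit d k r))"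

lemma norm_pairing [simp]: "cmod (pairing p r) = 1"
  by (simp add: pairing_def)

lemma pairing_nonzero [simp]: "pairing p r \<noteq> 0"
  using norm_pairing[of p r] by fastforce

lemma pairing_commute: "pairing p r = pairing r p"
  by (simp add: pairing_def mult.commute)

lemma pairing_lin_comb: "pairing p (lin_comb \<alpha> a \<beta> b) = pairing p a powi \<alpha> * pairing p b powi \<beta>"
proof -
  have "[(\<Sum>k<n. int (digit d k p) * int (digit d k (lin_comb \<alpha> a \<beta> b)))
      = (\<Sum>k<n. int (digit d k p) * (\<alpha> * int (digit d k a) + \<beta> * int (digit d k b)))] (mod int d)"
    by (intro cong_sum cong_mult cong_refl) (simp add: digit_lin_comb cong_def)
  then have "pairing p (lin_comb \<alpha> a \<beta> b)
      = chi d (\<Sum>k<n. int (digit d k p) * (\<alpha> * int (digit d k a) + \<beta> * int (digit d k b)))"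
    unfolding pairing_def by (rule chi_cong[OF d_pos])
  also have "(\<Sum>k<n. int (digit d k p) * (\<alpha> * int (digit d k a) + \<beta> * int (digit d k b)))
      = \<alpha> * (\<Sum>k<n. int (digit d k p) * int (digit d k a))
        + \<beta> * (\<Sum>k<n. int (digit d k p) * int (digit d k b))"
    by (simp add: sum_distrib_left sum.distrib ring_distribs mult_ac)
  finally show ?thesis by (simp add: pairing_def chi_add chi_mult)
qed

lemma cnj_pairing: "cnj (pairing p r) = inverse (pairing p r)"
  using complex_norm_square[of "pairing p r"] by (simp add: field_simps)

lemma pairing_vsub: "pairing p (vsub a b) = pairing p a * cnj (pairing p b)"
  by (simp add: pairing_lin_comb cnj_pairing power_int_minus)

lemma pairing_vadd_left: "pairing (vadd d n a b) p = pairing a p * pairing b p"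
  by (simp add: pairing_commute[of _ p] vadd_eq_lin_comb pairing_lin_comb)

lemma pairing_vscale_left: "pairing (vscale \<alpha> p) r = pairing p r powi \<alpha>"
  by (simp add: pairing_commute[of _ r] pairing_lin_comb)

lemma pairing_vscale_right: "pairing p (vscale \<alpha> r) = pairing p r powi \<alpha>"
  by (simp add: pairing_lin_comb)

lemma pairing_separates:
  assumes "r < D" "s < D" "r \<noteq> s"
  obtains u where "pairing u r \<noteq> pairing u s"
proof -
  obtain k where k: "k < n" "int (digit d k r) mod int d \<noteq> int (digit d k s) mod int d"
    using label_eqI assms by blast
  define u where "u = enc d n (\<lambda>j. if j = k then 1 else 0)"
  have u: "pairing u x = chi d (int (digit d k x))" for x
  proof -
    have "[(\<Sum>j<n. int (digit d j u) * int (digit d j x))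
        = (\<Sum>j<n. (if j = k then 1 else 0) * int (digit d j x))] (mod int d)"
      unfolding u_def by (intro cong_sum cong_mult cong_refl) (auto simp: digit_enc cong_def)
    then show ?thesis
      unfolding pairing_def using k(1) by (subst chi_cong[OF d_pos])
          (auto simp: if_distrib[of "\<lambda>c. c * _"] cong: if_cong)
  qed
  have "chi d (int (digit d k r) - int (digit d k s)) \<noteq> 1"
    using k(2) by (simp add: chi_eq_1_iff mod_eq_dvd_iff)
  then have "pairing u r \<noteq> pairing u s"
    using chi_add[of d "int (digit d k r) - int (digit d k s)" "int (digit d k s)"] pairing_nonzero[of u s]
    by (auto simp: u)
  then show ?thesis by (rule that)
qed

lemma pairing_orthogonal:
  assumes "r < D" "s < D"
  shows "(\<Sum>p<D. pairing p r * cnj (pairing p s)) = (if r = s then of_nat D else 0)"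
proof (cases "r = s")
  case False
  obtain u where u: "pairing u r \<noteq> pairing u s" using pairing_separates[OF assms False] .
  let ?S = "\<Sum>p<D. pairing p r * cnj (pairing p s)"
  have "?S = (\<Sum>p<D. pairing (vadd d n p u) r * cnj (pairing (vadd d n p u) s))"
    unfolding vadd_eq_lin_comb by (rule sum_lin_comb_left[symmetric]) simp
  also have "\<dots> = (pairing u r * cnj (pairing u s)) * ?S"
    unfolding sum_distrib_left by (simp add: pairing_vadd_left mult_ac)
  finally have "(pairing u r * cnj (pairing u s) - 1) * ?S = 0" by (simp add: algebra_simps)
  then show ?thesis using u False by (simp add: cnj_pairing field_simps)
qed (simp add: cnj_pairing)

lemma parseval:
  "(\<Sum>p<D. (cmod (\<Sum>r<D. pairing p r * h r))\<^sup>2) = real D * (\<Sum>r<D. (cmod (h r))\<^sup>2)"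
proof -
  have "of_real (\<Sum>p<D. (cmod (\<Sum>r<D. pairing p r * h r))\<^sup>2)
      = (\<Sum>p<D. \<Sum>r<D. \<Sum>s<D. (pairing p r * cnj (pairing p s)) * (h r * cnj (h s)))"
    unfolding of_real_sum complex_norm_square cnj_sum sum_product
    by (intro sum.cong refl) (simp add: mult_ac)
  also have "\<dots> = (\<Sum>r<D. \<Sum>p<D. \<Sum>s<D. (pairing p r * cnj (pairing p s)) * (h r * cnj (h s)))"
    by (rule sum.swap)
  also have "\<dots> = (\<Sum>r<D. \<Sum>s<D. (\<Sum>p<D. pairing p r * cnj (pairing p s)) * (h r * cnj (h s)))"
    unfolding sum_distrib_right by (intro sum.cong refl sum.swap)
  also have "\<dots> = (\<Sum>r<D. \<Sum>s<D. if r = s then of_nat D * (h r * cnj (h r)) else 0)"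
    by (intro sum.cong refl) (auto simp: pairing_orthogonal)
  also have "\<dots> = of_real (real D * (\<Sum>r<D. (cmod (h r))\<^sup>2))"
    unfolding of_real_mult of_real_sum complex_norm_square by (simp add: sum_distrib_left)
  finally show ?thesis unfolding of_real_eq_iff .
qed

section \<open>Weyl operators\<close>

definition weyl_phases :: "nat \<Rightarrow> nat \<Rightarrow> complex" where
  "weyl_phases p q = (\<Prod>k<n. weyl_phase d (digit d k p) (digit d k q))"

lemma norm_weyl_phases [simp]: "cmod (weyl_phases p q) = 1"
  by (simp add: weyl_phases_def weyl_phase_def prod_norm[symmetric] norm_power_int)

lemma weyl_phases_nonzero [simp]: "weyl_phases p q \<noteq> 0"
  using norm_weyl_phases[of p q] by fastforce

lemma eq_vsub_iff:
  assumes "r < D" "c < D"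
  shows "c = vsub r q \<longleftrightarrow> (\<forall>k<n. digit d k r = (digit d k c + digit d k q) mod d)"
proof -
  have "c = vsub r q \<longleftrightarrow> r = vadd d n c q"
    unfolding vadd_eq_lin_comb using assms by (auto simp: lin_comb_lin_comb_left lin_comb_1_0)
  also have "\<dots> \<longleftrightarrow> (\<forall>k<n. digit d k r = digit d k (vadd d n c q))"
    using assms label_eqI[of r "vadd d n c q"] by (auto simp: vadd_eq_lin_comb)
  also have "\<dots> \<longleftrightarrow> (\<forall>k<n. digit d k r = (digit d k c + digit d k q) mod d)"
    by (auto simp: vadd_def digit_enc nat_mod_as_int)
  finally show ?thesis .
qed

lemma weyl_carrier [simp]: "weyl d n p q \<in> carrier_mat D D"
  and dim_weyl [simp]: "dim_row (weyl d n p q) = D" "dim_col (weyl d n p q) = D"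
  by (simp_all add: weyl_def)

lemma weyl_entry:
  assumes "r < D" "c < D"
  shows "weyl d n p q $$ (r,c) = (if c = vsub r q then weyl_phases p q * pairing p r else 0)"
proof -
  have "weyl d n p q $$ (r,c) = (\<Prod>k<n. if digit d k r = (digit d k c + digit d k q) mod d
      then weyl_phase d (digit d k p) (digit d k q) * chi d (int (digit d k p) * int (digit d k r)) else 0)"
    using assms by (simp add: weyl_def weyl1_def digit_less)
  also have "\<dots> = (if \<forall>k<n. digit d k r = (digit d k c + digit d k q) mod d
      then weyl_phases p q * pairing p r else 0)"
    by (auto simp: weyl_phases_def pairing_def chi_sum prod.distrib intro!: prod_zero)
  finally show ?thesis by (simp only: eq_vsub_iff[OF assms])
qed

lemma weyl_mult_vec_entry:
  assumes "v \<in> carrier_vec D" "r < D"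
  shows "(weyl d n p q *\<^sub>v v) $ r = weyl_phases p q * pairing p r * v $ vsub r q"
proof -
  have "(weyl d n p q *\<^sub>v v) $ r
      = (\<Sum>c<D. if c = vsub r q then weyl_phases p q * pairing p r * v $ vsub r q else 0)"
    unfolding mult_mat_vec_entry[OF weyl_carrier assms]
    using assms by (intro sum.cong) (auto simp: weyl_entry)
  then show ?thesis by simp
qed

lemma weyl_0_0: "weyl d n 0 0 = 1\<^sub>m D"
proof (rule eq_matI)
  fix r c assume "r < dim_row (1\<^sub>m D :: complex mat)" "c < dim_col (1\<^sub>m D :: complex mat)"
  moreover from this have "vsub r 0 = r" by (intro label_eqI; simp add: label_simps)
  ultimately show "weyl d n 0 0 $$ (r,c) = 1\<^sub>m D $$ (r,c)"
    by (auto simp: weyl_entry weyl_phases_def weyl_phase_def pairing_def)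
qed (simp_all add: weyl_def)

lemma weyl_mult_entry:
  assumes "r < D" "c < D"
  shows "(weyl d n p q * weyl d n p' q') $$ (r,c) = (if c = vsub r (vadd d n q q')
    then weyl_phases p q * weyl_phases p' q' * cnj (pairing p' q) * pairing p r * pairing p' r else 0)"
proof -
  have "(weyl d n p q * weyl d n p' q') $$ (r,c) = (\<Sum>t<D. if t = vsub r q
      then weyl_phases p q * pairing p r * weyl d n p' q' $$ (vsub r q, c) else 0)"
    unfolding mult_mat_entry[OF weyl_carrier weyl_carrier assms]
    using assms by (intro sum.cong) (auto simp: weyl_entry)
  also have "\<dots> = weyl_phases p q * pairing p r * weyl d n p' q' $$ (vsub r q, c)" by simp
  finally show ?thesis using assms by (simp add: weyl_entry pairing_vsub vsub_vadd mult_ac)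
qed

definition weyl_cocycle :: "nat \<Rightarrow> nat \<Rightarrow> nat \<Rightarrow> nat \<Rightarrow> complex" where
  "weyl_cocycle p q p' q' = weyl_phases p q * weyl_phases p' q' * cnj (pairing p' q)
    / weyl_phases (vadd d n p p') (vadd d n q q')"

lemma weyl_cocycle_nonzero: "weyl_cocycle p q p' q' \<noteq> 0"
  by (simp add: weyl_cocycle_def)

lemma weyl_mult:
  "weyl d n p q * weyl d n p' q'
    = weyl_cocycle p q p' q' \<cdot>\<^sub>m weyl d n (vadd d n p p') (vadd d n q q')"
  by (rule eq_matI)
    (auto simp: weyl_cocycle_def weyl_mult_entry weyl_entry pairing_vadd_left simp del: index_mult_mat(1))

lemma weyl_commutation:
  "weyl d n p q * weyl d n p' q'
    = (pairing p q' * cnj (pairing p' q)) \<cdot>\<^sub>m (weyl d n p' q' * weyl d n p q)"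
proof -
  have "vadd d n a b = vadd d n b a" for a b by (simp add: vadd_def add.commute)
  then show ?thesis
    unfolding weyl_mult[of p q] weyl_mult[of p']
    by (auto simp: weyl_cocycle_def cnj_pairing intro!: eq_matI)
qed

lemma pure_state_weyl:
  assumes "pure_state D v"
  shows "pure_state D (weyl d n p q *\<^sub>v v)"
proof -
  have v: "v \<in> carrier_vec D" and unit: "(\<Sum>r<D. (cmod (v $ r))\<^sup>2) = 1"
    using assms by (auto simp: pure_state_def)
  have "(\<Sum>r<D. (cmod ((weyl d n p q *\<^sub>v v) $ r))\<^sup>2) = (\<Sum>r<D. (cmod (v $ vsub r q))\<^sup>2)"
    by (intro sum.cong refl) (simp add: weyl_mult_vec_entry[OF v] norm_mult del: index_mult_mat_vec)
  also have "\<dots> = (\<Sum>r<D. (cmod (v $ r))\<^sup>2)"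
    by (rule sum_lin_comb_left[of 1 "\<lambda>r. (cmod (v $ r))\<^sup>2"]) simp
  finally show ?thesis using unit mult_mat_vec_carrier[OF weyl_carrier v] by (simp add: pure_state_def)
qed

lemma pairing_eq_if_weyl_commute:
  assumes v: "pure_state D v"
    and commute: "(weyl d n p q * weyl d n p' q') *\<^sub>v v = (weyl d n p' q' * weyl d n p q) *\<^sub>v v"
  shows "pairing p q' = pairing p' q"
proof -
  define u where "u = (weyl d n p' q' * weyl d n p q) *\<^sub>v v"
  have v_carrier: "v \<in> carrier_vec D" using v by (rule pure_state_carrier)
  then have "u = weyl d n p' q' *\<^sub>v (weyl d n p q *\<^sub>v v)"
    unfolding u_def by (intro assoc_mult_mat_vec[of _ D D]) auto
  then have u: "pure_state D u" using pure_state_weyl v by simp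
  then obtain r where r: "r < D" "u $ r \<noteq> 0"
    using nonzero_vec_has_nonzero_entry pure_state_neq_0 by (metis pure_state_def)
  have "u = (pairing p q' * cnj (pairing p' q)) \<cdot>\<^sub>v u"
    using commute v_carrier unfolding u_def weyl_commutation[of p q]
    by (simp add: smult_mat_mult_vec)
  then have "u $ r = pairing p q' * cnj (pairing p' q) * u $ r"
    using u r(1) by (metis index_smult_vec(1) carrier_vecD pure_state_def)
  then show ?thesis using r(2) by (simp add: cnj_pairing field_simps)
qed

lemma weyl_commute_iff:
  "weyl d n p q * weyl d n p' q' = weyl d n p' q' * weyl d n p q \<longleftrightarrow> pairing p q' = pairing p' q"
proof
  assume "weyl d n p q * weyl d n p' q' = weyl d n p' q' * weyl d n p q"
  moreover obtain c where "pure_state D (c \<cdot>\<^sub>v unit_vec D 0)"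
    using normalize_pure_state[of "unit_vec D 0" D] by auto
  ultimately show "pairing p q' = pairing p' q" by (metis pairing_eq_if_weyl_commute)
next
  assume "pairing p q' = pairing p' q"
  then show "weyl d n p q * weyl d n p' q' = weyl d n p' q' * weyl d n p q"
    unfolding weyl_commutation[of p q] by (auto simp: cnj_pairing intro!: eq_matI)
qed

definition weyl_eigenvector :: "nat \<Rightarrow> nat \<Rightarrow> complex vec \<Rightarrow> bool" where
  "weyl_eigenvector p q v \<longleftrightarrow> (\<exists>c. weyl d n p q *\<^sub>v v = c \<cdot>\<^sub>v v)"

lemma weyl_eigenvector_smult:
  assumes v: "v \<in> carrier_vec D" and "weyl_eigenvector p q v"
  shows "weyl_eigenvector p q (a \<cdot>\<^sub>v v)"
proof -
  obtain c where "weyl d n p q *\<^sub>v v = c \<cdot>\<^sub>v v"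
    using assms(2) by (auto simp: weyl_eigenvector_def)
  then have "weyl d n p q *\<^sub>v (a \<cdot>\<^sub>v v) = c \<cdot>\<^sub>v (a \<cdot>\<^sub>v v)"
    using mult_mat_vec[OF weyl_carrier v] by (simp add: smult_smult_assoc mult.commute)
  then show ?thesis by (auto simp: weyl_eigenvector_def)
qed

lemma weyl_eigenvector_translate:
  assumes v: "v \<in> carrier_vec D" and "weyl_eigenvector p q v"
  shows "weyl_eigenvector p q (weyl d n x y *\<^sub>v v)"
proof -
  obtain c where eig: "weyl d n p q *\<^sub>v v = c \<cdot>\<^sub>v v"
    using assms(2) by (auto simp: weyl_eigenvector_def)
  have "weyl d n p q *\<^sub>v (weyl d n x y *\<^sub>v v) = (weyl d n p q * weyl d n x y) *\<^sub>v v"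
    using weyl_carrier weyl_carrier v by (rule assoc_mult_mat_vec[symmetric])
  also have "\<dots> = (pairing p y * cnj (pairing x q)) \<cdot>\<^sub>v (weyl d n x y *\<^sub>v (weyl d n p q *\<^sub>v v))"
    unfolding weyl_commutation[of p q] using v
    by (simp add: smult_mat_mult_vec assoc_mult_mat_vec[of _ D D _ D])
  also have "weyl d n x y *\<^sub>v (weyl d n p q *\<^sub>v v) = c \<cdot>\<^sub>v (weyl d n x y *\<^sub>v v)"
    unfolding eig using weyl_carrier v by (rule mult_mat_vec)
  finally show ?thesis unfolding weyl_eigenvector_def by (metis smult_smult_assoc)
qed

lemma weyl_twirl:
  assumes \<phi>: "pure_state D \<phi>" and rs: "r < D" "s < D"
  shows "(\<Sum>(x,y)\<in>{..<D} \<times> {..<D}. outer (weyl d n x y *\<^sub>v \<phi>) $$ (r,s))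
    = (if r = s then of_nat D else 0)"
proof -
  have carrier: "\<phi> \<in> carrier_vec D" using \<phi> by (rule pure_state_carrier)
  have entry: "outer (weyl d n x y *\<^sub>v \<phi>) $$ (r,s)
      = (pairing x r * cnj (pairing x s)) * (\<phi> $ vsub r y * cnj (\<phi> $ vsub s y))" for x y
  proof -
    have "weyl_phases x y * cnj (weyl_phases x y) = 1"
      using complex_norm_square[of "weyl_phases x y"] by simp
    moreover have W: "weyl d n x y *\<^sub>v \<phi> \<in> carrier_vec D"
      using weyl_carrier carrier by (rule mult_mat_vec_carrier)
    ultimately show ?thesis
      using rs by (simp add: outer_entry[OF W] weyl_mult_vec_entry[OF carrier] mult_ac
          del: index_mult_mat_vec)
  qed
  have "(\<Sum>(x,y)\<in>{..<D} \<times> {..<D}. outer (weyl d n x y *\<^sub>v \<phi>) $$ (r,s))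
      = (\<Sum>x<D. pairing x r * cnj (pairing x s)) * (\<Sum>y<D. \<phi> $ vsub r y * cnj (\<phi> $ vsub s y))"
    unfolding sum_product sum.cartesian_product entry ..
  also have "\<dots> = (if r = s then of_nat D else 0)"
  proof (cases "r = s")
    case True
    have "(\<Sum>y<D. \<phi> $ vsub r y * cnj (\<phi> $ vsub r y)) = (\<Sum>i<D. \<phi> $ i * cnj (\<phi> $ i))"
      by (rule sum_lin_comb_right) simp
    also have "\<dots> = of_real (\<Sum>i<D. (cmod (\<phi> $ i))\<^sup>2)" by (simp only: of_real_sum complex_norm_square)
    also have "\<dots> = 1" using \<phi> by (simp add: pure_state_def)
    finally show ?thesis using True rs by (simp add: pairing_orthogonal)
  qed (simp add: pairing_orthogonal[OF rs])
  finally show ?thesis .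
qed

section \<open>Characteristic functions\<close>

definition char_fun :: "complex mat \<Rightarrow> nat \<Rightarrow> nat \<Rightarrow> complex" where
  "char_fun A p q = trace (weyl d n p q * A)"

lemma char_fun_eq_sum:
  assumes "A \<in> carrier_mat D D"
  shows "char_fun A p q = weyl_phases p q * (\<Sum>r<D. pairing p r * A $$ (vsub r q, r))"
proof -
  have "char_fun A p q = (\<Sum>r<D. \<Sum>t<D. weyl d n p q $$ (r,t) * A $$ (t,r))"
    unfolding char_fun_def trace_def using weyl_carrier[of p q]
    by (auto simp: mult_mat_entry[OF weyl_carrier assms] simp del: index_mult_mat(1))
  also have "\<dots> = (\<Sum>r<D. \<Sum>t<D.
      if t = vsub r q then weyl_phases p q * pairing p r * A $$ (vsub r q, r) else 0)"
    by (intro sum.cong refl) (auto simp: weyl_entry)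
  finally show ?thesis by (simp add: sum_distrib_left mult.assoc)
qed

lemma sum_norm_char_fun_square:
  assumes "A \<in> carrier_mat D D"
  shows "(\<Sum>p<D. \<Sum>q<D. (cmod (char_fun A p q))\<^sup>2) = real D * purity D A"
proof -
  have "(\<Sum>p<D. \<Sum>q<D. (cmod (char_fun A p q))\<^sup>2)
      = (\<Sum>q<D. \<Sum>p<D. (cmod (\<Sum>r<D. pairing p r * A $$ (vsub r q, r)))\<^sup>2)"
    by (subst sum.swap) (simp add: char_fun_eq_sum[OF assms] norm_mult)
  also have "\<dots> = real D * (\<Sum>q<D. \<Sum>r<D. (cmod (A $$ (vsub r q, r)))\<^sup>2)"
    by (simp only: parseval sum_distrib_left)
  also have "(\<Sum>q<D. \<Sum>r<D. (cmod (A $$ (vsub r q, r)))\<^sup>2)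
      = (\<Sum>r<D. \<Sum>i<D. (cmod (A $$ (i, r)))\<^sup>2)"
    by (subst sum.swap) (simp add: sum_lin_comb_right[of _ "\<lambda>i. (cmod (A $$ (i, _)))\<^sup>2"])
  finally show ?thesis unfolding purity_def by (subst sum.swap)
qed

lemma norm_char_fun_le_1:
  assumes A: "density_op D A"
  shows "cmod (char_fun A p q) \<le> 1"
proof -
  let ?d = "\<lambda>r. Re (A $$ (r,r))"
  have "cmod (char_fun A p q) \<le> (\<Sum>r<D. cmod (A $$ (vsub r q, r)))"
    unfolding char_fun_eq_sum[OF density_op_carrier[OF A]] norm_mult norm_weyl_phases mult_1_left
    by (rule order_trans[OF norm_sum]) (simp add: norm_mult)
  also have "\<dots> \<le> (\<Sum>r<D. (?d (vsub r q) + ?d r) / 2)"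
    by (intro sum_mono density_op_entry_le[OF A]) auto
  also have "\<dots> = ((\<Sum>r<D. ?d (vsub r q)) + (\<Sum>r<D. ?d r)) / 2"
    by (simp add: sum.distrib flip: sum_divide_distrib)
  also have "(\<Sum>r<D. ?d (vsub r q)) = (\<Sum>r<D. ?d r)"
    by (rule sum_lin_comb_left) simp
  also have "(\<Sum>r<D. ?d r) = Re (trace A)"
    using density_op_carrier[OF A] by (simp add: trace_def)
  finally show ?thesis by (simp add: trace_density_op[OF A])
qed

lemma norm_char_fun_outer_eq_1_iff:
  assumes v: "pure_state D v"
  shows "cmod (char_fun (outer v) p q) = 1 \<longleftrightarrow> weyl_eigenvector p q v"
proof -
  have carrier: "v \<in> carrier_vec D" using v by (rule pure_state_carrier)
  have "char_fun (outer v) p q = (\<Sum>r<D. (weyl d n p q *\<^sub>v v) $ r * cnj (v $ r))"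
    unfolding char_fun_eq_sum[OF density_op_carrier[OF density_op_outer[OF v]]] sum_distrib_left
    by (intro sum.cong refl)
      (simp add: weyl_mult_vec_entry[OF carrier] outer_entry[OF carrier] mult_ac del: index_mult_mat_vec)
  then show ?thesis
    using cmod_inner_eq_1_iff[OF pure_state_weyl[OF v] v] by (simp add: weyl_eigenvector_def)
qed

section \<open>Stabilizer groups\<close>

definition stabilizer_group :: "complex vec \<Rightarrow> (nat \<times> nat) set" where
  "stabilizer_group v = {(p,q). p < D \<and> q < D \<and> weyl_eigenvector p q v}"

lemma stabilizer_group_subset: "stabilizer_group v \<subseteq> {..<D} \<times> {..<D}"
  by (auto simp: stabilizer_group_def)

lemma finite_stabilizer_group [simp]: "finite (stabilizer_group v)"
  using stabilizer_group_subset by (rule finite_subset) simp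

lemma zero_in_stabilizer_group: "v \<in> carrier_vec D \<Longrightarrow> (0,0) \<in> stabilizer_group v"
  by (auto simp: stabilizer_group_def weyl_eigenvector_def weyl_0_0 intro!: exI[of _ 1])

lemma weyl_product_eigenvector:
  assumes v: "v \<in> carrier_vec D"
    and "weyl d n p q *\<^sub>v v = c \<cdot>\<^sub>v v" "weyl d n p' q' *\<^sub>v v = c' \<cdot>\<^sub>v v"
  shows "(weyl d n p q * weyl d n p' q') *\<^sub>v v = (c * c') \<cdot>\<^sub>v v"
proof -
  have "(weyl d n p q * weyl d n p' q') *\<^sub>v v = weyl d n p q *\<^sub>v (c' \<cdot>\<^sub>v v)"
    using assms by (subst assoc_mult_mat_vec[of _ D D _ D]) auto
  also have "\<dots> = c' \<cdot>\<^sub>v (c \<cdot>\<^sub>v v)"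
    unfolding assms(2)[symmetric] using weyl_carrier v by (rule mult_mat_vec)
  finally show ?thesis by (simp add: smult_smult_assoc mult.commute)
qed

lemma stabilizer_group_vadd:
  assumes v: "v \<in> carrier_vec D" and "(p,q) \<in> stabilizer_group v" "(p',q') \<in> stabilizer_group v"
  shows "(vadd d n p p', vadd d n q q') \<in> stabilizer_group v"
proof -
  let ?W = "weyl d n (vadd d n p p') (vadd d n q q')" and ?\<gamma> = "weyl_cocycle p q p' q'"
  obtain c c' where "weyl d n p q *\<^sub>v v = c \<cdot>\<^sub>v v" "weyl d n p' q' *\<^sub>v v = c' \<cdot>\<^sub>v v"
    using assms(2,3) by (auto simp: stabilizer_group_def weyl_eigenvector_def)
  then have "?\<gamma> \<cdot>\<^sub>v (?W *\<^sub>v v) = (c * c') \<cdot>\<^sub>v v"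
    using weyl_product_eigenvector[OF v] v by (simp add: weyl_mult smult_mat_mult_vec)
  then have "(1 / ?\<gamma>) \<cdot>\<^sub>v (?\<gamma> \<cdot>\<^sub>v (?W *\<^sub>v v)) = (1 / ?\<gamma>) \<cdot>\<^sub>v ((c * c') \<cdot>\<^sub>v v)"
    by simp
  then have "?W *\<^sub>v v = (c * c' / ?\<gamma>) \<cdot>\<^sub>v v"
    by (simp add: smult_smult_assoc weyl_cocycle_nonzero)
  then show ?thesis by (auto simp: stabilizer_group_def weyl_eigenvector_def vadd_eq_lin_comb)
qed

lemma stabilizer_group_commute:
  assumes v: "pure_state D v" and "(p,q) \<in> stabilizer_group v" "(p',q') \<in> stabilizer_group v"
  shows "weyl d n p q * weyl d n p' q' = weyl d n p' q' * weyl d n p q"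
proof -
  have carrier: "v \<in> carrier_vec D" using v by (rule pure_state_carrier)
  obtain c c' where eig: "weyl d n p q *\<^sub>v v = c \<cdot>\<^sub>v v" "weyl d n p' q' *\<^sub>v v = c' \<cdot>\<^sub>v v"
    using assms(2,3) by (auto simp: stabilizer_group_def weyl_eigenvector_def)
  have "pairing p q' = pairing p' q"
    using weyl_product_eigenvector[OF carrier eig] weyl_product_eigenvector[OF carrier eig(2,1)]
    by (intro pairing_eq_if_weyl_commute[OF v]) (simp add: mult.commute)
  then show ?thesis by (simp add: weyl_commute_iff)
qed

lemma card_stabilizer_group_eq_sum:
  assumes v: "pure_state D v"
  shows "real (card (stabilizer_group v))
    = (\<Sum>(p,q)\<in>stabilizer_group v. (cmod (char_fun (outer v) p q))\<^sup>2)"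
proof -
  have "(cmod (char_fun (outer v) p q))\<^sup>2 = 1" if "(p,q) \<in> stabilizer_group v" for p q
    using that norm_char_fun_outer_eq_1_iff[OF v, of p q] by (simp add: stabilizer_group_def)
  then have "(\<Sum>(p,q)\<in>stabilizer_group v. (cmod (char_fun (outer v) p q))\<^sup>2) = (\<Sum>_\<in>stabilizer_group v. 1)"
    by (intro sum.cong) auto
  then show ?thesis by simp
qed

lemma sum_norm_char_fun_outer_square:
  assumes v: "pure_state D v"
  shows "(\<Sum>(p,q)\<in>{..<D} \<times> {..<D}. (cmod (char_fun (outer v) p q))\<^sup>2) = real D"
  using sum_norm_char_fun_square[OF density_op_carrier[OF density_op_outer[OF v]]]
  by (simp add: purity_outer[OF v] sum.cartesian_product)

lemma card_stabilizer_group_le: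
  assumes v: "pure_state D v"
  shows "card (stabilizer_group v) \<le> D"
proof -
  have "real (card (stabilizer_group v)) \<le> (\<Sum>(p,q)\<in>{..<D} \<times> {..<D}. (cmod (char_fun (outer v) p q))\<^sup>2)"
    unfolding card_stabilizer_group_eq_sum[OF v]
    by (intro sum_mono2 stabilizer_group_subset) auto
  then show ?thesis unfolding sum_norm_char_fun_outer_square[OF v] by (simp only: of_nat_le_iff)
qed

lemma stabilizer_state_iff_card:
  assumes v: "pure_state D v"
  shows "stabilizer_state d n v \<longleftrightarrow> card (stabilizer_group v) = D"
proof
  assume "stabilizer_state d n v"
  then obtain S where S: "S \<subseteq> {0..<D} \<times> {0..<D}" "card S = D"
    "\<forall>(p,q)\<in>S. \<exists>c. weyl d n p q *\<^sub>v v = c \<cdot>\<^sub>v v"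
    unfolding stabilizer_state_def by blast
  then have "S \<subseteq> stabilizer_group v" by (auto simp: stabilizer_group_def weyl_eigenvector_def)
  then have "D \<le> card (stabilizer_group v)" using card_mono S(2) finite_stabilizer_group by metis
  then show "card (stabilizer_group v) = D" using card_stabilizer_group_le[OF v] by simp
next
  assume card: "card (stabilizer_group v) = D"
  have carrier: "v \<in> carrier_vec D" using v by (rule pure_state_carrier)
  show "stabilizer_state d n v"
    unfolding stabilizer_state_def
  proof (intro conjI exI[of _ "stabilizer_group v"])
    show "stabilizer_group v \<subseteq> {0..<D} \<times> {0..<D}"
      using stabilizer_group_subset by (simp add: atLeast0LessThan)
    show "\<forall>(p,q)\<in>stabilizer_group v. \<exists>c. weyl d n p q *\<^sub>v v = c \<cdot>\<^sub>v v"
      by (auto simp: stabilizer_group_def weyl_eigenvector_def)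
  qed (use carrier card pure_state_neq_0[OF v] zero_in_stabilizer_group[OF carrier]
      stabilizer_group_vadd[OF carrier] stabilizer_group_commute[OF v] in auto)
qed

lemma stabilizer_state_if_norm_char_fun_0_or_1:
  assumes v: "pure_state D v"
    and flat: "\<And>p q. p < D \<Longrightarrow> q < D \<Longrightarrow> cmod (char_fun (outer v) p q) \<in> {0, 1}"
  shows "stabilizer_state d n v"
proof -
  have "real (card (stabilizer_group v)) = (\<Sum>(p,q)\<in>{..<D} \<times> {..<D}. (cmod (char_fun (outer v) p q))\<^sup>2)"
    unfolding card_stabilizer_group_eq_sum[OF v]
  proof (intro sum.mono_neutral_left stabilizer_group_subset ballI)
    fix x assume "x \<in> {..<D} \<times> {..<D} - stabilizer_group v"
    then obtain p q where "x = (p,q)" "p < D" "q < D" "cmod (char_fun (outer v) p q) \<noteq> 1"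
      by (auto simp: stabilizer_group_def norm_char_fun_outer_eq_1_iff[OF v])
    then show "(case x of (p,q) \<Rightarrow> (cmod (char_fun (outer v) p q))\<^sup>2) = 0"
      using flat[of p q] by simp
  qed simp
  then show ?thesis
    unfolding sum_norm_char_fun_outer_square[OF v] stabilizer_state_iff_card[OF v]
    by (simp only: of_nat_eq_iff)
qed

end

section \<open>Convolution of states\<close>

locale qudit_convolution = qudits +
  fixes g00 g01 g10 g11 :: int
  assumes positive: "coprime g00 (int d)" "coprime g01 (int d)"
      "coprime g10 (int d)" "coprime g11 (int d)"
    and det: "coprime (g00 * g11 - g01 * g10) (int d)"
begin

abbreviation N where "N \<equiv> inv_mod d (g00 * g11 - g01 * g10)"

abbreviation key1 where "key1 i j \<equiv> lin_comb (N * g11) i (- (N * g10)) j"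
abbreviation key2 where "key2 i j \<equiv> lin_comb (- (N * g01)) i (N * g00) j"
abbreviation inv_key1 where "inv_key1 a b \<equiv> lin_comb g00 a g10 b"
abbreviation inv_key2 where "inv_key2 a b \<equiv> lin_comb g01 a g11 b"

lemma coprime_N: "coprime N (int d)"
  using d_pos det by (rule coprime_inv_mod)

lemma inv_key_key:
  assumes "i < D" "j < D"
  shows "inv_key1 (key1 i j) (key2 i j) = i" "inv_key2 (key1 i j) (key2 i j) = j"
proof -
  note N_det = inv_mod_cong[OF d_pos det]
  have "inv_key1 (key1 i j) (key2 i j) = lin_comb 1 i 0 j"
    unfolding lin_comb_lin_comb using N_det by (intro lin_comb_cong) (simp_all add: algebra_simps)
  moreover have "inv_key2 (key1 i j) (key2 i j) = lin_comb 0 i 1 j"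
    unfolding lin_comb_lin_comb using N_det by (intro lin_comb_cong) (simp_all add: algebra_simps)
  ultimately show "inv_key1 (key1 i j) (key2 i j) = i" "inv_key2 (key1 i j) (key2 i j) = j"
    using assms by (simp_all add: lin_comb_1_0 lin_comb_0_1)
qed

lemma key_inv_key:
  assumes "a < D" "b < D"
  shows "key1 (inv_key1 a b) (inv_key2 a b) = a" "key2 (inv_key1 a b) (inv_key2 a b) = b"
proof -
  note N_det = inv_mod_cong[OF d_pos det]
  have "key1 (inv_key1 a b) (inv_key2 a b) = lin_comb 1 a 0 b"
    unfolding lin_comb_lin_comb using N_det by (intro lin_comb_cong) (simp_all add: algebra_simps)
  moreover have "key2 (inv_key1 a b) (inv_key2 a b) = lin_comb 0 a 1 b"
    unfolding lin_comb_lin_comb using N_det by (intro lin_comb_cong) (simp_all add: algebra_simps)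
  ultimately show "key1 (inv_key1 a b) (inv_key2 a b) = a" "key2 (inv_key1 a b) (inv_key2 a b) = b"
    using assms by (simp_all add: lin_comb_1_0 lin_comb_0_1)
qed

lemma sum_inv_key:
  fixes F :: "nat \<Rightarrow> nat \<Rightarrow> 'a :: comm_monoid_add"
  shows "(\<Sum>a<D. \<Sum>b<D. F (inv_key1 a b) (inv_key2 a b)) = (\<Sum>i<D. \<Sum>j<D. F i j)"
  unfolding sum.cartesian_product
  by (rule sum.reindex_bij_witness[of _ "\<lambda>(i,j). (key1 i j, key2 i j)"
        "\<lambda>(a,b). (inv_key1 a b, inv_key2 a b)"])
    (auto simp: inv_key_key key_inv_key)

lemma key_perm_eq:
  "key_perm d n g00 g01 g10 g11 x = key1 (x div D) (x mod D) * D + key2 (x div D) (x mod D)"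
  by (simp add: key_perm_def Let_def lin_comb_def)

lemma eq_key_perm_iff:
  assumes "x < D * D" "y < D * D"
  shows "y = key_perm d n g00 g01 g10 g11 x
    \<longleftrightarrow> x = inv_key1 (y div D) (y mod D) * D + inv_key2 (y div D) (y mod D)"
proof -
  have x: "x div D < D" "x mod D < D" and y: "y div D < D" "y mod D < D"
    using assms by (auto simp: less_mult_imp_div_less)
  show ?thesis
  proof
    assume "y = key_perm d n g00 g01 g10 g11 x"
    then have "y div D = key1 (x div D) (x mod D)" "y mod D = key2 (x div D) (x mod D)"
      by (simp_all add: key_perm_eq)
    then show "x = inv_key1 (y div D) (y mod D) * D + inv_key2 (y div D) (y mod D)"
      using x by (simp only: inv_key_key div_mult_mod_eq)
  next
    assume "x = inv_key1 (y div D) (y mod D) * D + inv_key2 (y div D) (y mod D)"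
    then have "x div D = inv_key1 (y div D) (y mod D)" "x mod D = inv_key2 (y div D) (y mod D)"
      by simp_all
    then show "y = key_perm d n g00 g01 g10 g11 x"
      using y by (simp only: key_perm_eq key_inv_key div_mult_mod_eq)
  qed
qed

abbreviation conv where "conv \<equiv> boxtimes d n g00 g01 g10 g11"

lemma conv_carrier [simp]: "conv \<rho> \<sigma> \<in> carrier_mat D D"
  and dim_conv [simp]: "dim_row (conv \<rho> \<sigma>) = D" "dim_col (conv \<rho> \<sigma>) = D"
  by (simp_all add: boxtimes_def ptrace2_def Let_def)

lemma conv_entry:
  assumes "a < D" "a' < D"
  shows "conv \<rho> \<sigma> $$ (a,a')
    = (\<Sum>b<D. \<rho> $$ (inv_key1 a b, inv_key1 a' b) * \<sigma> $$ (inv_key2 a b, inv_key2 a' b))"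
proof -
  let ?U = "key_unitary d n g00 g01 g10 g11"
  let ?w = "\<lambda>y. inv_key1 (y div D) (y mod D) * D + inv_key2 (y div D) (y mod D)"
  have "(?U * tensor D \<rho> \<sigma> * adj ?U) $$ (x,y) = tensor D \<rho> \<sigma> $$ (?w x, ?w y)"
    if "x < D * D" "y < D * D" for x y
    using that by (intro permutation_conjugate_entry[of _ "D * D"] mult_add_less lin_comb_less)
      (simp_all add: key_unitary_def tensor_def eq_key_perm_iff)
  then have "conv \<rho> \<sigma> $$ (a,a') = (\<Sum>b<D. tensor D \<rho> \<sigma> $$ (?w (a * D + b), ?w (a' * D + b)))"
    using assms by (simp add: boxtimes_def ptrace2_def Let_def mult_add_less)
  also have "\<dots> = (\<Sum>b<D. \<rho> $$ (inv_key1 a b, inv_key1 a' b) * \<sigma> $$ (inv_key2 a b, inv_key2 a' b))"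
    by (intro sum.cong refl) (simp add: tensor_def mult_add_less)
  finally show ?thesis .
qed

lemma trace_conv:
  assumes "\<rho> \<in> carrier_mat D D" "\<sigma> \<in> carrier_mat D D"
  shows "trace (conv \<rho> \<sigma>) = trace \<rho> * trace \<sigma>"
proof -
  have "trace (conv \<rho> \<sigma>)
      = (\<Sum>a<D. \<Sum>b<D. \<rho> $$ (inv_key1 a b, inv_key1 a b) * \<sigma> $$ (inv_key2 a b, inv_key2 a b))"
    by (simp add: trace_def conv_entry)
  also have "\<dots> = (\<Sum>i<D. \<Sum>j<D. \<rho> $$ (i,i) * \<sigma> $$ (j,j))"
    by (rule sum_inv_key[of "\<lambda>i j. \<rho> $$ (i,i) * \<sigma> $$ (j,j)"])
  finally show ?thesis using assms by (simp add: trace_def sum_product)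
qed

lemma density_op_conv:
  assumes \<rho>: "density_op D \<rho>" and v: "pure_state D v"
  shows "density_op D (conv \<rho> (outer v))"
  unfolding density_op_iff
proof (intro conjI allI impI)
  have carrier: "v \<in> carrier_vec D" using v by (rule pure_state_carrier)
  note \<sigma> = density_op_outer[OF v]
  show "trace (conv \<rho> (outer v)) = 1"
    using \<rho> \<sigma> by (simp add: trace_conv trace_density_op density_op_carrier)
  show "cnj (conv \<rho> (outer v) $$ (j,i)) = conv \<rho> (outer v) $$ (i,j)" if "i < D" "j < D" for i j
    using that by (simp add: conv_entry density_op_hermitian[OF \<rho>] density_op_hermitian[OF \<sigma>])
  fix f :: "nat \<Rightarrow> complex"
  define g where "g b a = cnj (v $ inv_key2 a b) * f a" for b a
  have "(\<Sum>i<D. \<Sum>j<D. cnj (f i) * conv \<rho> (outer v) $$ (i,j) * f j)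
      = (\<Sum>i<D. \<Sum>j<D. \<Sum>b<D. cnj (g b i) * \<rho> $$ (inv_key1 i b, inv_key1 j b) * g b j)"
    by (intro sum.cong refl)
      (simp add: conv_entry outer_entry[OF carrier] g_def sum_distrib_left sum_distrib_right mult_ac)
  also have "\<dots> = (\<Sum>i<D. \<Sum>b<D. \<Sum>j<D. cnj (g b i) * \<rho> $$ (inv_key1 i b, inv_key1 j b) * g b j)"
    by (intro sum.cong refl sum.swap)
  also have "\<dots> = (\<Sum>b<D. \<Sum>i<D. \<Sum>j<D. cnj (g b i) * \<rho> $$ (inv_key1 i b, inv_key1 j b) * g b j)"
    by (rule sum.swap)
  finally have "Re (\<Sum>i<D. \<Sum>j<D. cnj (f i) * conv \<rho> (outer v) $$ (i,j) * f j)
      = (\<Sum>b<D. Re (\<Sum>i<D. \<Sum>j<D. cnj (g b i) * \<rho> $$ (inv_key1 i b, inv_key1 j b) * g b j))"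
    by (simp only: Re_sum)
  also have "0 \<le> \<dots>"
    by (intro sum_nonneg density_op_pullback_nonneg[OF \<rho>]) auto
  finally show "0 \<le> Re (\<Sum>i<D. \<Sum>j<D. cnj (f i) * conv \<rho> (outer v) $$ (i,j) * f j)" .
qed simp

lemma state_channel_conv: "pure_state D v \<Longrightarrow> state_channel D (\<lambda>\<rho>. conv \<rho> (outer v))"
  by unfold_locales (rule density_op_conv)

lemma norm_char_fun_conv:
  assumes \<rho>: "\<rho> \<in> carrier_mat D D" and \<sigma>: "\<sigma> \<in> carrier_mat D D"
  shows "cmod (char_fun (conv \<rho> \<sigma>) p q)
    = cmod (char_fun \<rho> (vscale (N * g11) p) (vscale g00 q))
      * cmod (char_fun \<sigma> (vscale (- (N * g10)) p) (vscale g01 q))"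
proof -
  define F where "F i j = pairing p (key1 i j) *
    (\<rho> $$ (vsub i (vscale g00 q), i) * \<sigma> $$ (vsub j (vscale g01 q), j))" for i j
  have "(\<Sum>a<D. pairing p a * conv \<rho> \<sigma> $$ (vsub a q, a))
      = (\<Sum>a<D. \<Sum>b<D. F (inv_key1 a b) (inv_key2 a b))"
    unfolding F_def
    by (intro sum.cong refl) (simp add: conv_entry lin_comb_vsub key_inv_key sum_distrib_left)
  also have "\<dots> = (\<Sum>i<D. \<Sum>j<D. F i j)" by (rule sum_inv_key)
  also have "\<dots> = (\<Sum>i<D. pairing (vscale (N * g11) p) i * \<rho> $$ (vsub i (vscale g00 q), i))
      * (\<Sum>j<D. pairing (vscale (- (N * g10)) p) j * \<sigma> $$ (vsub j (vscale g01 q), j))"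
    unfolding sum_product F_def
    by (intro sum.cong refl) (simp add: pairing_lin_comb pairing_vscale_left mult_ac)
  finally show ?thesis
    by (simp add: char_fun_eq_sum \<rho> \<sigma> norm_mult)
qed

text \<open>The quotients of the label factors of \<open>\<rho>\<close> and \<open>\<sigma>\<close> in \<open>norm_char_fun_conv\<close>.\<close>

definition ratio_p :: int where "ratio_p = N * g11 * inv_mod d (- (N * g10))"
definition ratio_q :: int where "ratio_q = g00 * inv_mod d g01"

lemma coprime_ratios: "coprime ratio_p (int d)" "coprime ratio_q (int d)"
  unfolding ratio_p_def ratio_q_def using coprime_N positive by (simp_all add: coprime_inv_mod)

lemma purity_conv:
  assumes \<rho>: "\<rho> \<in> carrier_mat D D" and \<sigma>: "\<sigma> \<in> carrier_mat D D"
  shows "real D * purity D (conv \<rho> \<sigma>) = (\<Sum>p<D. \<Sum>q<D.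
    (cmod (char_fun \<rho> (vscale ratio_p p) (vscale ratio_q q)))\<^sup>2 * (cmod (char_fun \<sigma> p q))\<^sup>2)"
proof -
  have cop: "coprime (- (N * g10)) (int d)" using coprime_N positive by simp
  let ?a = "inv_mod d (- (N * g10))" and ?b = "inv_mod d g01"
  have "real D * purity D (conv \<rho> \<sigma>) = (\<Sum>p<D. \<Sum>q<D. (cmod (char_fun (conv \<rho> \<sigma>) p q))\<^sup>2)"
    by (simp add: sum_norm_char_fun_square)
  also have "\<dots> = (\<Sum>p<D. \<Sum>q<D. (cmod (char_fun (conv \<rho> \<sigma>) (vscale ?a p) (vscale ?b q)))\<^sup>2)"
    using cop positive
    by (intro sum_vscale[symmetric, of _ _ "\<lambda>p q. (cmod (char_fun (conv \<rho> \<sigma>) p q))\<^sup>2"])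
      (simp_all add: coprime_inv_mod)
  also have "\<dots> = (\<Sum>p<D. \<Sum>q<D.
    (cmod (char_fun \<rho> (vscale ratio_p p) (vscale ratio_q q)))\<^sup>2 * (cmod (char_fun \<sigma> p q))\<^sup>2)"
  proof (intro sum.cong refl)
    fix p q assume "p \<in> {..<D}" "q \<in> {..<D}"
    then have "vscale (- (N * g10)) (vscale ?a p) = p" "vscale g01 (vscale ?b q) = q"
      using cop positive by (simp_all add: vscale_inv_mod)
    then show "(cmod (char_fun (conv \<rho> \<sigma>) (vscale ?a p) (vscale ?b q)))\<^sup>2
      = (cmod (char_fun \<rho> (vscale ratio_p p) (vscale ratio_q q)))\<^sup>2 * (cmod (char_fun \<sigma> p q))\<^sup>2"
      by (simp add: norm_char_fun_conv[OF \<rho> \<sigma>] vscale_vscale ratio_p_def ratio_q_def power_mult_distrib)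
  qed
  finally show ?thesis .
qed

section \<open>Channels of maximal Holevo capacity\<close>

lemma sum_char_fun_defect_le:
  assumes \<rho>: "density_op D \<rho>" and \<sigma>: "density_op D \<sigma>"
  shows "(\<Sum>p<D. \<Sum>q<D. (cmod (char_fun \<sigma> p q))\<^sup>2 * (1 - (cmod (char_fun \<sigma> p q))\<^sup>2))
    \<le> 2 * real D * (1 - purity D (conv \<rho> \<sigma>))"
proof -
  define R where "R p q = (cmod (char_fun \<rho> (vscale ratio_p p) (vscale ratio_q q)))\<^sup>2" for p q
  define S where "S p q = (cmod (char_fun \<sigma> p q))\<^sup>2" for p q
  note carrier = density_op_carrier[OF \<rho>] density_op_carrier[OF \<sigma>]
  have R: "0 \<le> R p q" "R p q \<le> 1" and S: "0 \<le> S p q" "S p q \<le> 1" for p q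
    using norm_char_fun_le_1[OF \<rho>] norm_char_fun_le_1[OF \<sigma>] by (auto simp: R_def S_def abs_square_le_1)
  have "S p q * (1 - S p q) \<le> R p q + S p q - 2 * (R p q * S p q)" for p q
  proof -
    have "0 \<le> R p q * (1 - S p q) * (1 - S p q)" "0 \<le> S p q * (1 - R p q) * S p q"
      using R[of p q] S[of p q] by simp_all
    then show ?thesis by (simp add: algebra_simps)
  qed
  then have "(\<Sum>p<D. \<Sum>q<D. S p q * (1 - S p q)) \<le> (\<Sum>p<D. \<Sum>q<D. R p q + S p q - 2 * (R p q * S p q))"
    by (intro sum_mono)
  also have "\<dots> = (\<Sum>p<D. \<Sum>q<D. R p q) + (\<Sum>p<D. \<Sum>q<D. S p q) - 2 * (\<Sum>p<D. \<Sum>q<D. R p q * S p q)"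
    by (simp add: sum.distrib sum_subtractf sum_distrib_left)
  also have "(\<Sum>p<D. \<Sum>q<D. R p q * S p q) = real D * purity D (conv \<rho> \<sigma>)"
    unfolding purity_conv[OF carrier] R_def S_def ..
  also have "(\<Sum>p<D. \<Sum>q<D. R p q) = real D * purity D \<rho>"
    unfolding R_def sum_norm_char_fun_square[OF carrier(1), symmetric]
    by (rule sum_vscale[OF coprime_ratios, of "\<lambda>p q. (cmod (char_fun \<rho> p q))\<^sup>2"])
  also have "(\<Sum>p<D. \<Sum>q<D. S p q) = real D * purity D \<sigma>"
    unfolding S_def by (rule sum_norm_char_fun_square[OF carrier(2)])
  also have "real D * purity D \<rho> + real D * purity D \<sigma> - 2 * (real D * purity D (conv \<rho> \<sigma>))
      \<le> real D * 1 + real D * 1 - 2 * (real D * purity D (conv \<rho> \<sigma>))"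
    by (intro diff_right_mono add_mono mult_left_mono purity_le_1 \<rho> \<sigma>) simp_all
  finally show ?thesis by (simp add: S_def algebra_simps)
qed

lemma stabilizer_state_if_nearly_pure_outputs:
  assumes v: "pure_state D v"
    and nearly_pure: "\<And>\<epsilon>. \<epsilon> > 0 \<Longrightarrow> \<exists>\<rho>. density_op D \<rho> \<and> purity D (conv \<rho> (outer v)) > 1 - \<epsilon>"
  shows "stabilizer_state d n v"
proof -
  define s where "s p q = (cmod (char_fun (outer v) p q))\<^sup>2" for p q
  note \<sigma> = density_op_outer[OF v]
  have "(\<Sum>p<D. \<Sum>q<D. s p q * (1 - s p q)) \<le> 0 + e" if "e > 0" for e
  proof -
    have "e / (2 * real D) > 0" using that by simp
    then obtain \<rho> where \<rho>: "density_op D \<rho>" "purity D (conv \<rho> (outer v)) > 1 - e / (2 * real D)"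
      using nearly_pure by blast
    have "(\<Sum>p<D. \<Sum>q<D. s p q * (1 - s p q)) \<le> 2 * real D * (1 - purity D (conv \<rho> (outer v)))"
      unfolding s_def by (rule sum_char_fun_defect_le[OF \<rho>(1) \<sigma>])
    also have "\<dots> \<le> 2 * real D * (e / (2 * real D))"
      using \<rho>(2) by (intro mult_left_mono) auto
    finally show ?thesis by simp
  qed
  then have "(\<Sum>p<D. \<Sum>q<D. s p q * (1 - s p q)) \<le> 0" by (rule field_le_epsilon)
  moreover have nonneg: "0 \<le> s p q * (1 - s p q)" for p q
    using norm_char_fun_le_1[OF \<sigma>] by (simp add: s_def abs_square_le_1)
  ultimately have "(\<Sum>p<D. \<Sum>q<D. s p q * (1 - s p q)) = 0"
    by (intro antisym sum_nonneg) auto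
  then have "s p q * (1 - s p q) = 0" if "p < D" "q < D" for p q
    using nonneg that by (simp add: sum_nonneg_eq_0_iff sum_nonneg)
  then have "s p q = 0 \<or> s p q = 1" if "p < D" "q < D" for p q using that by force
  then have "cmod (char_fun (outer v) p q) \<in> {0, 1}" if "p < D" "q < D" for p q
    using that by (simp add: s_def abs_square_eq_1)
  then show ?thesis by (rule stabilizer_state_if_norm_char_fun_0_or_1[OF v])
qed

lemma purity_conv_eq_1_if_stabilized:
  assumes u: "pure_state D u" and v: "pure_state D v" and "stabilizer_state d n v"
    and stab: "\<And>p q. (p,q) \<in> stabilizer_group v
      \<Longrightarrow> weyl_eigenvector (vscale ratio_p p) (vscale ratio_q q) u"
  shows "purity D (conv (outer u) (outer v)) = 1"
proof -
  define F where "F p q = (cmod (char_fun (outer u) (vscale ratio_p p) (vscale ratio_q q)))\<^sup>2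
    * (cmod (char_fun (outer v) p q))\<^sup>2" for p q
  have "F p q = 1" if "(p,q) \<in> stabilizer_group v" for p q
  proof -
    have "weyl_eigenvector p q v" using that by (simp add: stabilizer_group_def)
    with stab[OF that] show ?thesis
      by (simp add: F_def norm_char_fun_outer_eq_1_iff[OF u, THEN iffD2]
          norm_char_fun_outer_eq_1_iff[OF v, THEN iffD2])
  qed
  then have "real (card (stabilizer_group v)) = (\<Sum>(p,q)\<in>stabilizer_group v. F p q)"
    by (subst sum.cong[OF refl, of _ _ "\<lambda>_. 1"]) auto
  also have "\<dots> \<le> (\<Sum>(p,q)\<in>{..<D} \<times> {..<D}. F p q)"
    by (intro sum_mono2 stabilizer_group_subset) (auto simp: F_def)
  also have "\<dots> = (\<Sum>p<D. \<Sum>q<D. F p q)" by (rule sum.cartesian_product[symmetric])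
  also have "\<dots> = real D * purity D (conv (outer u) (outer v))"
    unfolding F_def by (intro purity_conv[symmetric] density_op_carrier density_op_outer u v)
  finally have "1 \<le> purity D (conv (outer u) (outer v))"
    using assms(3) by (simp add: stabilizer_state_iff_card[OF v])
  moreover have "purity D (conv (outer u) (outer v)) \<le> 1"
    by (rule purity_le_1[OF density_op_conv[OF density_op_outer[OF u] v]])
  ultimately show ?thesis by simp
qed

lemma rescaled_stabilizer_common_eigenvector:
  assumes v: "pure_state D v"
  obtains \<phi> where "pure_state D \<phi>"
    "\<And>p q. (p,q) \<in> stabilizer_group v
      \<Longrightarrow> weyl_eigenvector (vscale ratio_p p) (vscale ratio_q q) \<phi>"
proof -
  define F where "F = (\<lambda>(p,q). weyl d n (vscale ratio_p p) (vscale ratio_q q)) ` stabilizer_group v"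
  have "A * B = B * A" if "A \<in> F" "B \<in> F" for A B
  proof -
    obtain p q p' q' where pq: "(p,q) \<in> stabilizer_group v" "(p',q') \<in> stabilizer_group v"
      and AB: "A = weyl d n (vscale ratio_p p) (vscale ratio_q q)"
        "B = weyl d n (vscale ratio_p p') (vscale ratio_q q')"
      using \<open>A \<in> F\<close> \<open>B \<in> F\<close> unfolding F_def by auto
    have "pairing p q' = pairing p' q"
      using stabilizer_group_commute[OF v pq] by (simp add: weyl_commute_iff)
    then show ?thesis
      unfolding AB weyl_commute_iff by (simp add: pairing_vscale_left pairing_vscale_right)
  qed
  moreover have "finite F" "\<And>A. A \<in> F \<Longrightarrow> A \<in> carrier_mat D D" by (auto simp: F_def)
  moreover have "D > 0" by simp
  ultimately obtain \<phi> where \<phi>: "\<phi> \<in> carrier_vec D" "\<phi> \<noteq> 0\<^sub>v D"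
    and eig: "\<And>A. A \<in> F \<Longrightarrow> \<exists>c. A *\<^sub>v \<phi> = c \<cdot>\<^sub>v \<phi>"
    using commuting_matrices_common_eigenvector by metis
  obtain a where a: "pure_state D (a \<cdot>\<^sub>v \<phi>)" using normalize_pure_state[OF \<phi>] .
  show ?thesis
  proof (rule that[OF a])
    fix p q assume "(p,q) \<in> stabilizer_group v"
    then have "weyl d n (vscale ratio_p p) (vscale ratio_q q) \<in> F" by (force simp: F_def)
    then have "weyl_eigenvector (vscale ratio_p p) (vscale ratio_q q) \<phi>"
      using eig by (simp add: weyl_eigenvector_def)
    then show "weyl_eigenvector (vscale ratio_p p) (vscale ratio_q q) (a \<cdot>\<^sub>v \<phi>)"
      by (rule weyl_eigenvector_smult[OF \<phi>(1)])
  qed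
qed

lemma sum_conv_scalar:
  assumes \<sigma>: "\<sigma> \<in> carrier_mat D D" and rs: "r < D" "s < D"
    and scalar: "\<And>i j. i < D \<Longrightarrow> j < D \<Longrightarrow> (\<Sum>x\<in>J. \<rho> x $$ (i,j)) = (if i = j then c else 0)"
  shows "(\<Sum>x\<in>J. conv (\<rho> x) \<sigma> $$ (r,s)) = (if r = s then c * trace \<sigma> else 0)"
proof -
  have "(\<Sum>x\<in>J. conv (\<rho> x) \<sigma> $$ (r,s))
      = (\<Sum>b<D. (\<Sum>x\<in>J. \<rho> x $$ (inv_key1 r b, inv_key1 s b)) * \<sigma> $$ (inv_key2 r b, inv_key2 s b))"
    unfolding conv_entry[OF rs] sum_distrib_right by (rule sum.swap)
  also have "\<dots> = (\<Sum>b<D. (if inv_key1 r b = inv_key1 s b then c else 0)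
      * \<sigma> $$ (inv_key2 r b, inv_key2 s b))"
    by (simp add: scalar)
  also have "\<dots> = (if r = s then c * trace \<sigma> else 0)"
  proof (cases "r = s")
    case True
    have "(\<Sum>b<D. \<sigma> $$ (inv_key2 r b, inv_key2 r b)) = trace \<sigma>"
      using \<sigma> sum_lin_comb_right[OF positive(4), of "\<lambda>b. \<sigma> $$ (b,b)"] by (simp add: trace_def)
    then show ?thesis using True by (simp flip: sum_distrib_left)
  next
    case False
    then have "inv_key1 r b \<noteq> inv_key1 s b" for b
      using lin_comb_left_inverse[OF positive(1)] rs by metis
    then show ?thesis using False by simp
  qed
  finally show ?thesis .
qed

lemma maximal_holevo_capacity_if_stabilizer_state:
  assumes v: "pure_state D v" and st: "stabilizer_state d n v"
  shows "holevo_capacity D (\<lambda>\<rho>. conv \<rho> (outer v)) = ln (real D)"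
proof -
  interpret state_channel D "\<lambda>\<rho>. conv \<rho> (outer v)" by (rule state_channel_conv[OF v])
  note \<sigma> = density_op_outer[OF v]
  obtain \<phi> where \<phi>: "pure_state D \<phi>" and eig: "\<And>p q. (p,q) \<in> stabilizer_group v
      \<Longrightarrow> weyl_eigenvector (vscale ratio_p p) (vscale ratio_q q) \<phi>"
    using rescaled_stabilizer_common_eigenvector[OF v] by blast
  define u where "u = (\<lambda>(x,y). weyl d n x y *\<^sub>v \<phi>)"
  have u: "pure_state D (u j)" for j by (cases j) (simp add: u_def pure_state_weyl \<phi>)
  have "purity D (conv (outer (u j)) (outer v)) = 1" for j
  proof (rule purity_conv_eq_1_if_stabilized[OF u v st])
    fix p q assume "(p,q) \<in> stabilizer_group v"
    with eig \<phi> show "weyl_eigenvector (vscale ratio_p p) (vscale ratio_q q) (u j)"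
      by (cases j) (simp add: u_def weyl_eigenvector_translate pure_state_def)
  qed
  moreover have "(\<Sum>j\<in>{..<D} \<times> {..<D}. conv (outer (u j)) (outer v) $$ (r,s))
      = (if r = s then of_nat (card ({..<D} \<times> {..<D})) / of_nat D else 0)"
    if rs: "r < D" "s < D" for r s
  proof -
    have "(\<Sum>j\<in>{..<D} \<times> {..<D}. conv (outer (u j)) (outer v) $$ (r,s))
        = (if r = s then of_nat D * trace (outer v) else 0)"
      using weyl_twirl[OF \<phi>]
      by (intro sum_conv_scalar[OF density_op_carrier[OF \<sigma>] rs]) (simp add: u_def case_prod_unfold)
    then show ?thesis by (simp add: trace_density_op[OF \<sigma>])
  qed
  ultimately show ?thesis
    by (intro maximal_holevo_capacityI[of "{..<D} \<times> {..<D}" "\<lambda>j. outer (u j)"] density_op_outer u)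
      (simp_all add: lessThan_empty_iff)
qed

theorem maximal_holevo_capacity_iff_stabilizer_state:
  assumes v: "pure_state D v"
  shows "holevo_capacity D (\<lambda>\<rho>. conv \<rho> (outer v)) = ln (real D) \<longleftrightarrow> stabilizer_state d n v"
proof
  assume cap: "holevo_capacity D (\<lambda>\<rho>. conv \<rho> (outer v)) = ln (real D)"
  interpret state_channel D "\<lambda>\<rho>. conv \<rho> (outer v)" by (rule state_channel_conv[OF v])
  show "stabilizer_state d n v"
    using maximal_holevo_capacity_nearly_pure_output[OF cap _ density_op_outer[OF v]]
    by (intro stabilizer_state_if_nearly_pure_outputs[OF v]) blast
qed (rule maximal_holevo_capacity_if_stabilizer_state[OF v])

end

lemma coprime_if_not_cong_0:
  fixes a :: int
  assumes "prime d" "\<not> [a = 0] (mod int d)"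
  shows "coprime a (int d)"
  using assms prime_imp_coprime[of "int d" a] by (simp add: cong_0_iff coprime_commute)

theorem mainTheorem16:
  fixes d n :: nat and g00 g01 g10 g11 :: int and \<psi> :: "complex vec"
  assumes "prime d"
    and "n \<ge> 1"
    and "\<not> [g00 = 0] (mod int d)" and "\<not> [g01 = 0] (mod int d)"
    and "\<not> [g10 = 0] (mod int d)" and "\<not> [g11 = 0] (mod int d)"
    and "\<not> [g00 * g11 - g01 * g10 = 0] (mod int d)"
    and "\<psi> \<in> carrier_vec (d ^ n)"
    and "(\<Sum>i<d ^ n. (cmod (\<psi> $ i))\<^sup>2) = 1"
  shows "holevo_capacity (d ^ n) (\<lambda>\<rho>. boxtimes d n g00 g01 g10 g11 \<rho> (outer \<psi>))
           = real n * ln (real d)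
         \<longleftrightarrow> stabilizer_state d n \<psi>"
proof -
  interpret qudit_convolution d n g00 g01 g10 g11
    using assms by unfold_locales (simp_all add: prime_gt_0_nat coprime_if_not_cong_0)
  have "pure_state (d ^ n) \<psi>" using assms(8,9) by (simp add: pure_state_def)
  then have "holevo_capacity (d ^ n) (\<lambda>\<rho>. conv \<rho> (outer \<psi>)) = ln (real (d ^ n))
      \<longleftrightarrow> stabilizer_state d n \<psi>"
    by (rule maximal_holevo_capacity_iff_stabilizer_state)
  moreover have "ln (real (d ^ n)) = real n * ln (real d)" by (simp add: ln_realpow)
  ultimately show ?thesis by simp
qed

end
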